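(* Let $\mathbf{T}=(T,m,e)$ be an opmonoidal monad on a monoidal category $(\mathbb{V},\otimes,\mathbb{I})$. The following are equivalent: (a) the functor $K_{1_{\mathbb{I}},\mathbf{I}}:\mathbb{V}\to\mathbb{V}^{T(\mathbf{I})}_T$, $V\mapsto((T(V),m_V),\chi_{V,\mathbb{I}})$, is an equivalence of categories; (b) (i) $\mathbf{T}$ (with the comodule structure $\chi_{-,\mathbb{I}}:T(-)\to T(-)\otimes T(\mathbb{I})$) is $\mathbf{G}_{T(\mathbf{I})}$-Galois, and (ii) $\mathbf{T}$ is of effective descent type.
   Context: Monoidal categories are taken to be strict. An opmonoidal monad on $\mathbb{V}$ is a monad $(T,m,e)$ together with a natural transformation $\chi_{V,W}:T(V\otimes W)\to T(V)\otimes T(W)$ and a morphism $\theta:T(\mathbb{I})\to\mathbb{I}$ such that $(\chi_{U,V}\otimes T(W))\chi_{U\otimes V,W}=(T(U)\otimes\chi_{V,W})\chi_{U,V\otimes W}$, $(\theta\otimes T(V))\chi_{\mathbb{I},V}=1=(T(V)\otimes\theta)\chi_{V,\mathbb{I}}$, $\chi_{V,W}m_{V\otimes W}=(m_V\otimes m_W)\chi_{T(V),T(W)}T(\chi_{V,W})$, $\theta m_{\mathbb{I}}=\theta T(\theta)$, $\chi_{V,W}e_{V\otimes W}=e_V\otimes e_W$, $\theta e_{\mathbb{I}}=1$. $T(\mathbf{I})=(T(\mathbb{I}),\chi_{\mathbb{I},\mathbb{I}},\theta)$ is a comonoid in $\mathbb{V}$. $\mathbb{V}^{T(\mathbf{I})}_T$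 is the category of triples $(V,h,\rho)$ with $(V,h)$ a $\mathbf{T}$-module (Eilenberg–Moore algebra), $\rho:V\to V\otimes T(\mathbb{I})$ a right $T(\mathbf{I})$-comodule structure, and $\rho\cdot h=(h\otimes m_{\mathbb{I}})\cdot\chi_{V,T(\mathbb{I})}\cdot T(\rho)$; morphisms are morphisms in $\mathbb{V}$ that respect both structures. $\mathbf{G}_{T(\mathbf{I})}$ is the comonad $-\otimes T(\mathbb{I})$ on $\mathbb{V}$; $\mathbf{T}$ is $\mathbf{G}_{T(\mathbf{I})}$-Galois if for every $V$ the composite $TT(V)\xrightarrow{\chi_{T(V),\mathbb{I}}}TT(V)\otimes T(\mathbb{I})\xrightarrow{m_V\otimes T(\mathbb{I})}T(V)\otimes T(\mathbb{I})$ is an isomorphism. $\mathbf{T}$ is of effective descent type if the free functor $\phi_T:\mathbb{V}\to\mathbb{V}_T$ into the Eilenberg–Moore category is comonadic (the comparison functor to coalgebras over the comonad $\phi_TU_T$ is an equivalence). *)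

theory Defs
  imports Main
begin

section \<open>Categories, functors, natural transformations\<close>

text \<open>
  Objects and arrows form sets inside two arbitrary types, and every arrow has exactly one domain
  and one codomain. Composition is written in the order of application of maps: \<open>g \<cdot> f\<close> is
  first \<open>f\<close>, then \<open>g\<close>. Values of the operations outside the carriers are irrelevant.
\<close>

record ('o, 'a) category =
  Obj :: "'o set"
  Arr :: "'a set"
  Dom :: "'a \<Rightarrow> 'o"
  Cod :: "'a \<Rightarrow> 'o"
  Idt :: "'o \<Rightarrow> 'a"
  Cmp :: "'a \<Rightarrow> 'a \<Rightarrow> 'a"  (infixl "\<cdot>\<index>" 70)

definition Hom :: "('o, 'a, 'z) category_scheme \<Rightarrow> 'o \<Rightarrow> 'o \<Rightarrow> 'a set" where
  "Hom C A B = {f \<in> Arr C. Dom C f = A \<and> Cod C f = B}"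

locale category =
  fixes C :: "('o, 'a, 'z) category_scheme" (structure)
  assumes Dom_Obj: "f \<in> Arr C \<Longrightarrow> Dom C f \<in> Obj C"
    and Cod_Obj: "f \<in> Arr C \<Longrightarrow> Cod C f \<in> Obj C"
    and Idt_Hom: "A \<in> Obj C \<Longrightarrow> Idt C A \<in> Hom C A A"
    and Cmp_Hom: "\<lbrakk>f \<in> Hom C A B; g \<in> Hom C B D\<rbrakk> \<Longrightarrow> g \<cdot> f \<in> Hom C A D"
    and Cmp_Idt: "f \<in> Hom C A B \<Longrightarrow> f \<cdot> Idt C A = f"
    and Idt_Cmp: "f \<in> Hom C A B \<Longrightarrow> Idt C B \<cdot> f = f"
    and Cmp_assoc: "\<lbrakk>f \<in> Hom C A B; g \<in> Hom C B D; h \<in> Hom C D E\<rbrakk>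
      \<Longrightarrow> (h \<cdot> g) \<cdot> f = h \<cdot> (g \<cdot> f)"

definition is_iso :: "('o, 'a, 'z) category_scheme \<Rightarrow> 'a \<Rightarrow> bool" where
  "is_iso C f \<longleftrightarrow> f \<in> Arr C \<and>
    (\<exists>g \<in> Hom C (Cod C f) (Dom C f).
      g \<cdot>\<^bsub>C\<^esub> f = Idt C (Dom C f) \<and> f \<cdot>\<^bsub>C\<^esub> g = Idt C (Cod C f))"

record ('o, 'a, 'p, 'b) cat_functor =
  FObj :: "'o \<Rightarrow> 'p"
  FArr :: "'a \<Rightarrow> 'b"

locale cat_functor = C: category C + D: category D
  for C :: "('o, 'a, 'y) category_scheme" and D :: "('p, 'b, 'z) category_scheme" +
  fixes F :: "('o, 'a, 'p, 'b, 'w) cat_functor_scheme"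
  assumes FObj_Obj: "A \<in> Obj C \<Longrightarrow> FObj F A \<in> Obj D"
    and FArr_Hom: "f \<in> Hom C A B \<Longrightarrow> FArr F f \<in> Hom D (FObj F A) (FObj F B)"
    and FArr_Idt: "A \<in> Obj C \<Longrightarrow> FArr F (Idt C A) = Idt D (FObj F A)"
    and FArr_Cmp: "\<lbrakk>f \<in> Hom C A B; g \<in> Hom C B E\<rbrakk>
      \<Longrightarrow> FArr F (g \<cdot>\<^bsub>C\<^esub> f) = FArr F g \<cdot>\<^bsub>D\<^esub> FArr F f"

definition id_functor :: "('o, 'a, 'o, 'a) cat_functor" where
  "id_functor = \<lparr>FObj = (\<lambda>A. A), FArr = (\<lambda>f. f)\<rparr>"

definition comp_functor ::
    "('p, 'b, 'q, 'c, 'w) cat_functor_scheme \<Rightarrow> ('o, 'a, 'p, 'b, 'v) cat_functor_scheme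
      \<Rightarrow> ('o, 'a, 'q, 'c) cat_functor" where
  "comp_functor G F = \<lparr>FObj = FObj G \<circ> FObj F, FArr = FArr G \<circ> FArr F\<rparr>"

locale nat_trans = F: cat_functor C D F + G: cat_functor C D G
  for C :: "('o, 'a, 'y) category_scheme" and D :: "('p, 'b, 'z) category_scheme"
    and F :: "('o, 'a, 'p, 'b, 'v) cat_functor_scheme"
    and G :: "('o, 'a, 'p, 'b, 'w) cat_functor_scheme" +
  fixes \<tau> :: "'o \<Rightarrow> 'b"
  assumes component: "A \<in> Obj C \<Longrightarrow> \<tau> A \<in> Hom D (FObj F A) (FObj G A)"
    and naturality: "f \<in> Hom C A B \<Longrightarrow> \<tau> B \<cdot>\<^bsub>D\<^esub> FArr F f = FArr G f \<cdot>\<^bsub>D\<^esub> \<tau> A"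

locale nat_iso = nat_trans +
  assumes component_iso: "A \<in> Obj C \<Longrightarrow> is_iso D (\<tau> A)"

definition equivalence ::
    "('o, 'a, 'y) category_scheme \<Rightarrow> ('p, 'b, 'z) category_scheme
      \<Rightarrow> ('o, 'a, 'p, 'b, 'w) cat_functor_scheme \<Rightarrow> bool" where
  "equivalence C D F \<longleftrightarrow> cat_functor C D F \<and>
    (\<exists>(G :: ('p, 'b, 'o, 'a) cat_functor) \<eta> \<epsilon>. cat_functor D C G \<and>
      nat_iso C C id_functor (comp_functor G F) \<eta> \<and>
      nat_iso D D (comp_functor F G) id_functor \<epsilon>)"

text \<open>
  The category of objects \<open>X \<in> S\<close> carrying extra structure on the object \<open>U X\<close> of \<open>C\<close>; its arrows
  are the \<open>f : U X \<rightarrow> U Y\<close> of \<open>C\<close> with \<open>P X f Y\<close>, tagged with \<open>X\<close> and \<open>Y\<close> so that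
  domain and codomain are determined by the arrow.
\<close>

definition structured_category ::
    "('o, 'a, 'z) category_scheme \<Rightarrow> 'p set \<Rightarrow> ('p \<Rightarrow> 'o) \<Rightarrow> ('p \<Rightarrow> 'a \<Rightarrow> 'p \<Rightarrow> bool)
      \<Rightarrow> ('p, 'p \<times> 'a \<times> 'p) category" where
  "structured_category C S U P =
    \<lparr>Obj = S,
     Arr = {(X, f, Y). X \<in> S \<and> Y \<in> S \<and> f \<in> Hom C (U X) (U Y) \<and> P X f Y},
     Dom = (\<lambda>(X, f, Y). X),
     Cod = (\<lambda>(X, f, Y). Y),
     Idt = (\<lambda>X. (X, Idt C (U X), X)),
     Cmp = (\<lambda>(Y', g, Z) (X, f, Y). (X, g \<cdot>\<^bsub>C\<^esub> f, Z))\<rparr>"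


section \<open>Monads and their modules\<close>

record ('o, 'a) monad = "('o, 'a, 'o, 'a) cat_functor" +
  mult :: "'o \<Rightarrow> 'a"
  unit :: "'o \<Rightarrow> 'a"

locale monad = category C
  for C :: "('o, 'a, 'z) category_scheme" (structure) +
  fixes T :: "('o, 'a, 'w) monad_scheme"
  assumes T_functor: "cat_functor C C T"
    and mult_nat: "nat_trans C C (comp_functor T T) T (mult T)"
    and unit_nat: "nat_trans C C id_functor T (unit T)"
    and mult_assoc: "A \<in> Obj C \<Longrightarrow>
      mult T A \<cdot> mult T (FObj T A) = mult T A \<cdot> FArr T (mult T A)"
    and mult_unit_left: "A \<in> Obj C \<Longrightarrow> mult T A \<cdot> unit T (FObj T A) = Idt C (FObj T A)"
    and mult_unit_right: "A \<in> Obj C \<Longrightarrow> mult T A \<cdot> FArr T (unit T A) = Idt C (FObj T A)"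

definition is_module ::
    "('o, 'a, 'z) category_scheme \<Rightarrow> ('o, 'a, 'w) monad_scheme \<Rightarrow> 'o \<Rightarrow> 'a \<Rightarrow> bool" where
  "is_module C T A h \<longleftrightarrow> A \<in> Obj C \<and> h \<in> Hom C (FObj T A) A \<and>
    h \<cdot>\<^bsub>C\<^esub> mult T A = h \<cdot>\<^bsub>C\<^esub> FArr T h \<and> h \<cdot>\<^bsub>C\<^esub> unit T A = Idt C A"

definition module_map ::
    "('o, 'a, 'z) category_scheme \<Rightarrow> ('o, 'a, 'w) monad_scheme \<Rightarrow> 'a \<Rightarrow> 'a \<Rightarrow> 'a \<Rightarrow> bool" where
  "module_map C T h f k \<longleftrightarrow> f \<cdot>\<^bsub>C\<^esub> h = k \<cdot>\<^bsub>C\<^esub> FArr T f"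

definition EM_category ::
    "('o, 'a, 'z) category_scheme \<Rightarrow> ('o, 'a, 'w) monad_scheme
      \<Rightarrow> ('o \<times> 'a, ('o \<times> 'a) \<times> 'a \<times> ('o \<times> 'a)) category" where
  "EM_category C T = structured_category C {(A, h). is_module C T A h} fst
    (\<lambda>X f Y. module_map C T (snd X) f (snd Y))"

definition forgetful_functor ::
    "('o \<times> 'a, ('o \<times> 'a) \<times> 'a \<times> ('o \<times> 'a), 'o, 'a) cat_functor" where
  "forgetful_functor = \<lparr>FObj = fst, FArr = (\<lambda>(X, f, Y). f)\<rparr>"

definition free_module :: "('o, 'a, 'w) monad_scheme \<Rightarrow> 'o \<Rightarrow> 'o \<times> 'a" where
  "free_module T A = (FObj T A, mult T A)"

definition free_functor ::
    "('o, 'a, 'z) category_scheme \<Rightarrow> ('o, 'a, 'w) monad_scheme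
      \<Rightarrow> ('o, 'a, 'o \<times> 'a, ('o \<times> 'a) \<times> 'a \<times> ('o \<times> 'a)) cat_functor" where
  "free_functor C T = \<lparr>FObj = free_module T,
    FArr = (\<lambda>f. (free_module T (Dom C f), FArr T f, free_module T (Cod C f)))\<rparr>"

text \<open>The component at \<open>(A, h)\<close> is the module morphism \<open>h : (T A, m\<^sub>A) \<rightarrow> (A, h)\<close>.\<close>

definition EM_counit ::
    "('o, 'a, 'w) monad_scheme \<Rightarrow> 'o \<times> 'a \<Rightarrow> ('o \<times> 'a) \<times> 'a \<times> ('o \<times> 'a)" where
  "EM_counit T X = (free_module T (fst X), snd X, X)"


section \<open>Comonads, coalgebras and comonadicity\<close>

record ('o, 'a) comonad = "('o, 'a, 'o, 'a) cat_functor" +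
  comult :: "'o \<Rightarrow> 'a"
  counit :: "'o \<Rightarrow> 'a"

definition coalgebra_category ::
    "('o, 'a, 'z) category_scheme \<Rightarrow> ('o, 'a, 'w) comonad_scheme
      \<Rightarrow> ('o \<times> 'a, ('o \<times> 'a) \<times> 'a \<times> ('o \<times> 'a)) category" where
  "coalgebra_category C G = structured_category C
    {(A, r). A \<in> Obj C \<and> r \<in> Hom C A (FObj G A) \<and>
      comult G A \<cdot>\<^bsub>C\<^esub> r = FArr G r \<cdot>\<^bsub>C\<^esub> r \<and> counit G A \<cdot>\<^bsub>C\<^esub> r = Idt C A}
    fst
    (\<lambda>X f Y. snd Y \<cdot>\<^bsub>C\<^esub> f = FArr G f \<cdot>\<^bsub>C\<^esub> snd X)"

text \<open>
  For an adjunction \<open>L \<stileturn> R : B \<rightarrow> A\<close> with unit \<open>\<eta>\<close> and counit \<open>\<epsilon>\<close>: the comonad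
  \<open>(L R, L \<eta> R, \<epsilon>)\<close> on \<open>B\<close> and the comparison functor \<open>a \<mapsto> (L a, L \<eta>\<^sub>a)\<close>.
\<close>

definition adjunction_comonad ::
    "('o, 'a, 'p, 'b) cat_functor \<Rightarrow> ('p, 'b, 'o, 'a) cat_functor \<Rightarrow> ('o \<Rightarrow> 'a) \<Rightarrow> ('p \<Rightarrow> 'b)
      \<Rightarrow> ('p, 'b) comonad" where
  "adjunction_comonad L R \<eta> \<epsilon> =
    \<lparr>FObj = FObj (comp_functor L R), FArr = FArr (comp_functor L R),
     comult = (\<lambda>B. FArr L (\<eta> (FObj R B))), counit = \<epsilon>\<rparr>"

definition comparison_functor ::
    "('o, 'a, 'z) category_scheme \<Rightarrow> ('o, 'a, 'p, 'b) cat_functor \<Rightarrow> ('o \<Rightarrow> 'a)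
      \<Rightarrow> ('o, 'a, 'p \<times> 'b, ('p \<times> 'b) \<times> 'b \<times> ('p \<times> 'b)) cat_functor" where
  "comparison_functor A L \<eta> =
    (let K = (\<lambda>X. (FObj L X, FArr L (\<eta> X)))
     in \<lparr>FObj = K, FArr = (\<lambda>f. (K (Dom A f), FArr L f, K (Cod A f)))\<rparr>)"

definition free_comonad ::
    "('o, 'a, 'z) category_scheme \<Rightarrow> ('o, 'a, 'w) monad_scheme
      \<Rightarrow> ('o \<times> 'a, ('o \<times> 'a) \<times> 'a \<times> ('o \<times> 'a)) comonad" where
  "free_comonad C T =
    adjunction_comonad (free_functor C T) forgetful_functor (unit T) (EM_counit T)"

definition effective_descent_type ::
    "('o, 'a, 'z) category_scheme \<Rightarrow> ('o, 'a, 'w) monad_scheme \<Rightarrow> bool" where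
  "effective_descent_type C T \<longleftrightarrow>
    equivalence C (coalgebra_category (EM_category C T) (free_comonad C T))
      (comparison_functor C (free_functor C T) (unit T))"


section \<open>Strict monoidal categories and opmonoidal monads\<close>

record ('o, 'a) monoidal_category = "('o, 'a) category" +
  TObj :: "'o \<Rightarrow> 'o \<Rightarrow> 'o"  (infixl "\<otimes>\<index>" 75)
  TArr :: "'a \<Rightarrow> 'a \<Rightarrow> 'a"  (infixl "\<otimes>\<^sub>a\<index>" 75)
  UnitObj :: "'o"  ("\<I>\<index>")

locale strict_monoidal_category = category V
  for V :: "('o, 'a, 'z) monoidal_category_scheme" (structure) +
  assumes UnitObj_Obj: "\<I> \<in> Obj V"
    and TObj_Obj: "\<lbrakk>A \<in> Obj V; B \<in> Obj V\<rbrakk> \<Longrightarrow> A \<otimes> B \<in> Obj V"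
    and TArr_Hom: "\<lbrakk>f \<in> Hom V A B; g \<in> Hom V A' B'\<rbrakk> \<Longrightarrow> f \<otimes>\<^sub>a g \<in> Hom V (A \<otimes> A') (B \<otimes> B')"
    and TArr_Idt: "\<lbrakk>A \<in> Obj V; B \<in> Obj V\<rbrakk> \<Longrightarrow> Idt V A \<otimes>\<^sub>a Idt V B = Idt V (A \<otimes> B)"
    and TArr_Cmp: "\<lbrakk>f \<in> Hom V A B; g \<in> Hom V B D; f' \<in> Hom V A' B'; g' \<in> Hom V B' D'\<rbrakk>
      \<Longrightarrow> (g \<cdot> f) \<otimes>\<^sub>a (g' \<cdot> f') = (g \<otimes>\<^sub>a g') \<cdot> (f \<otimes>\<^sub>a f')"
    and TObj_assoc: "\<lbrakk>A \<in> Obj V; B \<in> Obj V; D \<in> Obj V\<rbrakk> \<Longrightarrow> (A \<otimes> B) \<otimes> D = A \<otimes> (B \<otimes> D)"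
    and TArr_assoc: "\<lbrakk>f \<in> Arr V; g \<in> Arr V; h \<in> Arr V\<rbrakk> \<Longrightarrow> (f \<otimes>\<^sub>a g) \<otimes>\<^sub>a h = f \<otimes>\<^sub>a (g \<otimes>\<^sub>a h)"
    and TObj_I_left: "A \<in> Obj V \<Longrightarrow> \<I> \<otimes> A = A"
    and TObj_I_right: "A \<in> Obj V \<Longrightarrow> A \<otimes> \<I> = A"
    and TArr_I_left: "f \<in> Arr V \<Longrightarrow> Idt V \<I> \<otimes>\<^sub>a f = f"
    and TArr_I_right: "f \<in> Arr V \<Longrightarrow> f \<otimes>\<^sub>a Idt V \<I> = f"

record ('o, 'a) opmonoidal_monad = "('o, 'a) monad" +
  chi :: "'o \<Rightarrow> 'o \<Rightarrow> 'a"
  theta :: "'a"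

locale opmonoidal_monad = strict_monoidal_category V + monad V T
  for V :: "('o, 'a, 'z) monoidal_category_scheme" (structure)
    and T :: "('o, 'a, 'w) opmonoidal_monad_scheme" +
  assumes chi_Hom: "\<lbrakk>A \<in> Obj V; B \<in> Obj V\<rbrakk>
      \<Longrightarrow> chi T A B \<in> Hom V (FObj T (A \<otimes> B)) (FObj T A \<otimes> FObj T B)"
    and chi_nat: "\<lbrakk>f \<in> Hom V A A'; g \<in> Hom V B B'\<rbrakk>
      \<Longrightarrow> chi T A' B' \<cdot> FArr T (f \<otimes>\<^sub>a g) = (FArr T f \<otimes>\<^sub>a FArr T g) \<cdot> chi T A B"
    and theta_Hom: "theta T \<in> Hom V (FObj T \<I>) \<I>"
    and chi_coassoc: "\<lbrakk>A \<in> Obj V; B \<in> Obj V; D \<in> Obj V\<rbrakk> \<Longrightarrow>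
      (chi T A B \<otimes>\<^sub>a Idt V (FObj T D)) \<cdot> chi T (A \<otimes> B) D
        = (Idt V (FObj T A) \<otimes>\<^sub>a chi T B D) \<cdot> chi T A (B \<otimes> D)"
    and chi_counit_left: "A \<in> Obj V \<Longrightarrow>
      (theta T \<otimes>\<^sub>a Idt V (FObj T A)) \<cdot> chi T \<I> A = Idt V (FObj T A)"
    and chi_counit_right: "A \<in> Obj V \<Longrightarrow>
      (Idt V (FObj T A) \<otimes>\<^sub>a theta T) \<cdot> chi T A \<I> = Idt V (FObj T A)"
    and chi_mult: "\<lbrakk>A \<in> Obj V; B \<in> Obj V\<rbrakk> \<Longrightarrow>
      chi T A B \<cdot> mult T (A \<otimes> B)
        = (mult T A \<otimes>\<^sub>a mult T B) \<cdot> chi T (FObj T A) (FObj T B) \<cdot> FArr T (chi T A B)"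
    and theta_mult: "theta T \<cdot> mult T \<I> = theta T \<cdot> FArr T (theta T)"
    and chi_unit: "\<lbrakk>A \<in> Obj V; B \<in> Obj V\<rbrakk> \<Longrightarrow>
      chi T A B \<cdot> unit T (A \<otimes> B) = unit T A \<otimes>\<^sub>a unit T B"
    and theta_unit: "theta T \<cdot> unit T \<I> = Idt V \<I>"

record ('o, 'a) comonoid =
  carrier :: "'o"
  cocomp :: "'a"
  coun :: "'a"

definition TI_comonoid ::
    "('o, 'a, 'z) monoidal_category_scheme \<Rightarrow> ('o, 'a, 'w) opmonoidal_monad_scheme
      \<Rightarrow> ('o, 'a) comonoid" where
  "TI_comonoid V T =
    \<lparr>carrier = FObj T \<I>\<^bsub>V\<^esub>, cocomp = chi T \<I>\<^bsub>V\<^esub> \<I>\<^bsub>V\<^esub>, coun = theta T\<rparr>"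

definition is_right_comodule ::
    "('o, 'a, 'z) monoidal_category_scheme \<Rightarrow> ('o, 'a) comonoid \<Rightarrow> 'o \<Rightarrow> 'a \<Rightarrow> bool" where
  "is_right_comodule V M A r \<longleftrightarrow> A \<in> Obj V \<and> r \<in> Hom V A (A \<otimes>\<^bsub>V\<^esub> carrier M) \<and>
    (r \<otimes>\<^sub>a\<^bsub>V\<^esub> Idt V (carrier M)) \<cdot>\<^bsub>V\<^esub> r = (Idt V A \<otimes>\<^sub>a\<^bsub>V\<^esub> cocomp M) \<cdot>\<^bsub>V\<^esub> r \<and>
    (Idt V A \<otimes>\<^sub>a\<^bsub>V\<^esub> coun M) \<cdot>\<^bsub>V\<^esub> r = Idt V A"

definition comodule_map ::
    "('o, 'a, 'z) monoidal_category_scheme \<Rightarrow> ('o, 'a) comonoid \<Rightarrow> 'a \<Rightarrow> 'a \<Rightarrow> 'a \<Rightarrow> bool" where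
  "comodule_map V M r f s \<longleftrightarrow> s \<cdot>\<^bsub>V\<^esub> f = (f \<otimes>\<^sub>a\<^bsub>V\<^esub> Idt V (carrier M)) \<cdot>\<^bsub>V\<^esub> r"

definition Hopf_module_category ::
    "('o, 'a, 'z) monoidal_category_scheme \<Rightarrow> ('o, 'a, 'w) opmonoidal_monad_scheme
      \<Rightarrow> ('o \<times> 'a \<times> 'a, ('o \<times> 'a \<times> 'a) \<times> 'a \<times> ('o \<times> 'a \<times> 'a)) category" where
  "Hopf_module_category V T = structured_category V
    {(A, h, r). is_module V T A h \<and> is_right_comodule V (TI_comonoid V T) A r \<and>
      r \<cdot>\<^bsub>V\<^esub> h = (h \<otimes>\<^sub>a\<^bsub>V\<^esub> mult T \<I>\<^bsub>V\<^esub>) \<cdot>\<^bsub>V\<^esub> chi T A (FObj T \<I>\<^bsub>V\<^esub>) \<cdot>\<^bsub>V\<^esub> FArr T r}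
    fst
    (\<lambda>(A, h, r) f (B, k, s).
      module_map V T h f k \<and> comodule_map V (TI_comonoid V T) r f s)"

text \<open>
  The functor \<open>K\<close> with \<open>K A = ((T A, m\<^sub>A), \<chi>\<^sub>A\<^sub>,\<^sub>I)\<close> and \<open>K f = T f\<close>; since the tensor product is
  strict, \<open>\<chi>\<^sub>A\<^sub>,\<^sub>I\<close> has domain \<open>T (A \<otimes> I) = T A\<close>.
\<close>

definition K_functor ::
    "('o, 'a, 'z) monoidal_category_scheme \<Rightarrow> ('o, 'a, 'w) opmonoidal_monad_scheme
      \<Rightarrow> ('o, 'a, 'o \<times> 'a \<times> 'a, ('o \<times> 'a \<times> 'a) \<times> 'a \<times> ('o \<times> 'a \<times> 'a)) cat_functor" where
  "K_functor V T =
    (let K = (\<lambda>A. (FObj T A, mult T A, chi T A \<I>\<^bsub>V\<^esub>))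
     in \<lparr>FObj = K, FArr = (\<lambda>f. (K (Dom V f), FArr T f, K (Cod V f)))\<rparr>)"

definition Galois ::
    "('o, 'a, 'z) monoidal_category_scheme \<Rightarrow> ('o, 'a, 'w) opmonoidal_monad_scheme \<Rightarrow> bool" where
  "Galois V T \<longleftrightarrow> (\<forall>A \<in> Obj V.
    is_iso V ((mult T A \<otimes>\<^sub>a\<^bsub>V\<^esub> Idt V (FObj T \<I>\<^bsub>V\<^esub>)) \<cdot>\<^bsub>V\<^esub> chi T (FObj T A) \<I>\<^bsub>V\<^esub>))"

end

theory Submission
  imports Defs
begin

text \<open>
  Let \<open>(A, h)\<close> be a module over the opmonoidal monad \<open>T\<close>. Its canonical map
  \<open>t\<^sub>h = (h \<otimes> T I) \<cdot> \<chi>\<^sub>A\<^sub>,\<^sub>I : T A \<rightarrow> A \<otimes> T I\<close> compares two comonads on the category of modules: the comonad of the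
  free-forgetful adjunction, with value \<open>(T A, m\<^sub>A)\<close>, and the comonad \<open>A \<mapsto> A \<otimes> T I\<close>, whose coalgebras
  are the Hopf modules. The maps \<open>t\<^sub>h\<close> form a morphism of comonads, and \<open>K\<close> is the comparison functor
  of the first comonad followed by the functor \<open>(A, h, r) \<mapsto> (A, h, t\<^sub>h \<cdot> r)\<close> on coalgebras.

  If every \<open>t\<^sub>h\<close> is invertible, the functor on coalgebras is an isomorphism of categories
  (\<open>is_Hopf_module_can_iff\<close>, \<open>is_Hopf_map_can_iff\<close>), so \<open>K\<close> is an equivalence exactly if the comparison
  functor is one (\<open>equivalence_K_iff\<close>). It remains to see that each of the two conditions makes every \<open>t\<^sub>h\<close>
  invertible.

  The Galois condition gives this for free modules. A general module is a coequalizer of free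
  ones that is split in the base category; such a coequalizer is preserved by \<open>T\<close> and by \<open>- \<otimes> T I\<close>, so \<open>t\<^sub>h\<close> is
  invertible too. The lemma \<open>Galois_can_iso\<close> makes the inverse explicit.

  If \<open>K\<close> is an equivalence, the cofree Hopf module on \<open>(A, h)\<close> is isomorphic to some \<open>K B\<close>. Maps from
  \<open>K B'\<close> into the cofree Hopf module correspond to module maps \<open>T B' \<rightarrow> A\<close> and hence to arrows \<open>B' \<rightarrow> A\<close>, with
  \<open>t\<^sub>h : K A \<rightarrow> A \<otimes> T I\<close> corresponding to the identity of \<open>A\<close>. So \<open>B\<close> represents the same functor as \<open>A\<close>, and
  \<open>t\<^sub>h\<close> is the given isomorphism up to the resulting isomorphism of \<open>A\<close> with \<open>B\<close> (\<open>equivalence_can_iso\<close>).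
\<close>

section \<open>Arrows, isomorphisms and equivalences\<close>

lemma Hom_iff: "f \<in> Hom C A B \<longleftrightarrow> f \<in> Arr C \<and> Dom C f = A \<and> Cod C f = B"
  by (simp add: Hom_def)

context category
begin

lemma Arr_Hom: "f \<in> Arr C \<Longrightarrow> f \<in> Hom C (Dom C f) (Cod C f)"
  by (simp add: Hom_iff)

text \<open>The typing rules below are in terms of \<open>Dom\<close> and \<open>Cod\<close> instead of \<open>Hom\<close>: their premises then
  contain no variables beyond those of the arrows, so the simplifier can type composites.\<close>

lemma Idt_arr [simp]:
  assumes "A \<in> Obj C"
  shows "Idt C A \<in> Arr C" "Dom C (Idt C A) = A" "Cod C (Idt C A) = A"
  using Idt_Hom[OF assms] by (simp_all add: Hom_iff)

lemma Cmp_arr [simp]: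
  assumes "f \<in> Arr C" "g \<in> Arr C" "Dom C g = Cod C f"
  shows "g \<cdot> f \<in> Arr C" "Dom C (g \<cdot> f) = Dom C f" "Cod C (g \<cdot> f) = Cod C g"
  using Cmp_Hom[of f _ _ g] assms by (simp_all add: Hom_iff)

lemma Cmp_Idt_arr [simp]: "f \<in> Arr C \<Longrightarrow> Dom C f = A \<Longrightarrow> f \<cdot> Idt C A = f"
  using Cmp_Idt by (auto simp: Hom_iff)

lemma Idt_Cmp_arr [simp]: "f \<in> Arr C \<Longrightarrow> Cod C f = A \<Longrightarrow> Idt C A \<cdot> f = f"
  using Idt_Cmp by (auto simp: Hom_iff)

lemma Cmp_assoc_arr [simp]:
  "\<lbrakk>f \<in> Arr C; g \<in> Arr C; h \<in> Arr C; Dom C g = Cod C f; Dom C h = Cod C g\<rbrakk>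
    \<Longrightarrow> (h \<cdot> g) \<cdot> f = h \<cdot> (g \<cdot> f)"
  using Cmp_assoc[of f _ _ g _ h] by (simp add: Hom_iff)

text \<open>Composites are normalized to the right, where \<open>g \<cdot> f\<close> is no longer a subterm; an equation
  for \<open>g \<cdot> f\<close> has to be extended before it applies in front of a further arrow.\<close>

lemma Cmp_rewrite:
  assumes "g \<cdot> f = k" "x \<in> Arr C" "f \<in> Arr C" "g \<in> Arr C" "Dom C f = Cod C x" "Dom C g = Cod C f"
  shows "g \<cdot> (f \<cdot> x) = k \<cdot> x"
  using assms Cmp_assoc_arr[of x f g] by simp

lemma is_isoI:
  assumes "f \<in> Hom C A B" "g \<in> Hom C B A" "g \<cdot> f = Idt C A" "f \<cdot> g = Idt C B"
  shows "is_iso C f"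
  using assms by (auto simp: is_iso_def Hom_iff)

lemma is_isoE:
  assumes "is_iso C f" "f \<in> Hom C A B"
  obtains g where "g \<in> Hom C B A" "g \<cdot> f = Idt C A" "f \<cdot> g = Idt C B"
  using assms by (auto simp: is_iso_def Hom_iff)

lemma iso_cancel_left:
  assumes "is_iso C f" and x: "x \<in> Arr C" "Cod C x = Dom C f"
    and y: "y \<in> Arr C" "Cod C y = Dom C f" and eq: "f \<cdot> x = f \<cdot> y"
  shows "x = y"
proof -
  have f: "f \<in> Arr C" using assms(1) by (simp add: is_iso_def)
  obtain g where g: "g \<in> Hom C (Cod C f) (Dom C f)" "g \<cdot> f = Idt C (Dom C f)"
    using assms(1) by (auto simp: is_iso_def)
  have "g \<cdot> (f \<cdot> x) = g \<cdot> (f \<cdot> y)" by (simp add: eq)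
  then have "(g \<cdot> f) \<cdot> x = (g \<cdot> f) \<cdot> y"
    using f g(1) x y by (simp add: Hom_iff)
  then show ?thesis using g(2) x y by simp
qed

lemma iso_cancel_right:
  assumes "is_iso C f" and x: "x \<in> Arr C" "Dom C x = Cod C f"
    and y: "y \<in> Arr C" "Dom C y = Cod C f" and eq: "x \<cdot> f = y \<cdot> f"
  shows "x = y"
proof -
  have f: "f \<in> Arr C" using assms(1) by (simp add: is_iso_def)
  obtain g where g: "g \<in> Hom C (Cod C f) (Dom C f)" "f \<cdot> g = Idt C (Cod C f)"
    using assms(1) by (auto simp: is_iso_def)
  have "(x \<cdot> f) \<cdot> g = (y \<cdot> f) \<cdot> g" by (simp add: eq)
  then have "x \<cdot> (f \<cdot> g) = y \<cdot> (f \<cdot> g)"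
    using f g(1) x y by (simp add: Hom_iff)
  then show ?thesis using g(2) x y by simp
qed

lemma is_iso_Cmp:
  assumes "is_iso C f" "is_iso C g" "Dom C g = Cod C f"
  shows "is_iso C (g \<cdot> f)"
proof -
  have f: "f \<in> Arr C" and g: "g \<in> Arr C" using assms by (auto simp: is_iso_def)
  obtain f' where f': "f' \<in> Hom C (Cod C f) (Dom C f)" "f' \<cdot> f = Idt C (Dom C f)"
      "f \<cdot> f' = Idt C (Cod C f)"
    using assms(1) by (auto simp: is_iso_def)
  obtain g' where g': "g' \<in> Hom C (Cod C g) (Dom C g)" "g' \<cdot> g = Idt C (Dom C g)"
      "g \<cdot> g' = Idt C (Cod C g)"
    using assms(2) by (auto simp: is_iso_def)
  have "g' \<cdot> (g \<cdot> f) = f" "f \<cdot> (f' \<cdot> g') = g'"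
    using Cmp_rewrite[OF g'(2), of f] Cmp_rewrite[OF f'(3), of g'] f g f' g' assms(3)
    by (auto simp: Hom_iff)
  then show ?thesis
    using f g f' g' assms(3)
    by (intro is_isoI[of _ "Dom C f" "Cod C g" "f' \<cdot> g'"]) (auto simp: Hom_iff)
qed

end

lemma (in cat_functor) FArr_arr:
  assumes "f \<in> Arr C"
  shows "FArr F f \<in> Arr D" "Dom D (FArr F f) = FObj F (Dom C f)"
    "Cod D (FArr F f) = FObj F (Cod C f)"
  using FArr_Hom[OF C.Arr_Hom[OF assms]] by (simp_all add: Hom_iff)

lemma (in cat_functor) FArr_Cmp_arr:
  "\<lbrakk>f \<in> Arr C; g \<in> Arr C; Dom C g = Cod C f\<rbrakk>
    \<Longrightarrow> FArr F (g \<cdot>\<^bsub>C\<^esub> f) = FArr F g \<cdot>\<^bsub>D\<^esub> FArr F f"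
  using FArr_Cmp[of f _ _ g] by (simp add: Hom_iff)

lemma (in cat_functor) FArr_is_iso:
  assumes "is_iso C f" shows "is_iso D (FArr F f)"
proof -
  have f: "f \<in> Hom C (Dom C f) (Cod C f)" using assms by (simp add: is_iso_def Hom_iff)
  obtain g where g: "g \<in> Hom C (Cod C f) (Dom C f)" "g \<cdot>\<^bsub>C\<^esub> f = Idt C (Dom C f)"
      "f \<cdot>\<^bsub>C\<^esub> g = Idt C (Cod C f)"
    by (rule C.is_isoE[OF assms f])
  have fA: "f \<in> Arr C" using f by (simp add: Hom_iff)
  show ?thesis
    by (rule D.is_isoI[OF FArr_Hom[OF f] FArr_Hom[OF g(1)]])
      (use f g fA in \<open>simp_all add: FArr_Cmp[symmetric] FArr_Idt C.Dom_Obj C.Cod_Obj\<close>)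
qed

lemma cat_functor_comp:
  assumes "cat_functor C D F" "cat_functor D E G"
  shows "cat_functor C E (comp_functor G F)"
proof -
  interpret F: cat_functor C D F by fact
  interpret G: cat_functor D E G by fact
  show ?thesis
  proof
    fix f g A B X assume "f \<in> Hom C A B" "g \<in> Hom C B X"
    then show "FArr (comp_functor G F) (g \<cdot>\<^bsub>C\<^esub> f)
        = FArr (comp_functor G F) g \<cdot>\<^bsub>E\<^esub> FArr (comp_functor G F) f"
      by (simp add: comp_functor_def F.FArr_Cmp G.FArr_Cmp[OF F.FArr_Hom F.FArr_Hom])
  qed (simp_all add: comp_functor_def F.FObj_Obj G.FObj_Obj F.FArr_Hom G.FArr_Hom
      F.FArr_Idt G.FArr_Idt)
qed

lemma cat_functor_cong:
  assumes "cat_functor C D F"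
    and obj: "\<And>A. A \<in> Obj C \<Longrightarrow> FObj F' A = FObj F A"
    and arr: "\<And>f. f \<in> Arr C \<Longrightarrow> FArr F' f = FArr F f"
  shows "cat_functor C D F'"
proof -
  interpret F: cat_functor C D F by fact
  show ?thesis
  proof
    fix A assume "A \<in> Obj C"
    then show "FObj F' A \<in> Obj D" "FArr F' (Idt C A) = Idt D (FObj F' A)"
      by (simp_all add: obj arr F.FObj_Obj F.FArr_Idt)
  next
    fix f A B assume f: "f \<in> Hom C A B"
    then have "A \<in> Obj C" "B \<in> Obj C" "f \<in> Arr C"
      using F.C.Dom_Obj F.C.Cod_Obj by (auto simp: Hom_iff)
    then show "FArr F' f \<in> Hom D (FObj F' A) (FObj F' B)"
      using F.FArr_Hom[OF f] by (simp add: obj arr)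
    fix g E assume g: "g \<in> Hom C B E"
    then show "FArr F' (g \<cdot>\<^bsub>C\<^esub> f) = FArr F' g \<cdot>\<^bsub>D\<^esub> FArr F' f"
      using f by (simp add: Hom_iff arr F.FArr_Cmp_arr)
  qed
qed

lemma equivalence_ess_surj:
  assumes "equivalence C D F" "Y \<in> Obj D"
  obtains A s where "A \<in> Obj C" "s \<in> Hom D (FObj F A) Y" "is_iso D s"
proof -
  obtain G \<eta> \<epsilon> where G: "cat_functor D C (G :: (_, _, _, _) cat_functor)"
      and e: "nat_iso D D (comp_functor F G) id_functor \<epsilon>"
    using assms(1) by (auto simp: equivalence_def)
  interpret G: cat_functor D C G by fact
  interpret e: nat_iso D D "comp_functor F G" id_functor \<epsilon> by fact
  show thesis
    using that[OF G.FObj_Obj[OF assms(2)], of "\<epsilon> Y"] e.component[OF assms(2)]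
      e.component_iso[OF assms(2)]
    by (simp add: comp_functor_def id_functor_def)
qed

text \<open>A preimage of \<open>f\<close> is \<open>\<eta>\<^sub>B\<inverse> \<cdot> G f \<cdot> \<eta>\<^sub>A\<close>. Naturality of \<open>\<eta>\<close> shows that its image under \<open>G F\<close>
  is \<open>G f\<close>, and \<open>G\<close> is faithful because \<open>F G\<close> is isomorphic to the identity.\<close>

lemma equivalence_full:
  assumes "equivalence C D F" and A: "A \<in> Obj C" and B: "B \<in> Obj C"
    and f: "f \<in> Hom D (FObj F A) (FObj F B)"
  obtains v where "v \<in> Hom C A B" "FArr F v = f"
proof -
  obtain G \<eta> \<epsilon> where F: "cat_functor C D F" and G: "cat_functor D C (G :: (_, _, _, _) cat_functor)"
      and n: "nat_iso C C id_functor (comp_functor G F) \<eta>"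
      and e: "nat_iso D D (comp_functor F G) id_functor \<epsilon>"
    using assms(1) by (auto simp: equivalence_def)
  interpret F: cat_functor C D F by fact
  interpret G: cat_functor D C G by fact
  interpret n: nat_iso C C id_functor "comp_functor G F" \<eta> by fact
  interpret e: nat_iso D D "comp_functor F G" id_functor \<epsilon> by fact
  let ?GF = "\<lambda>A. FObj G (FObj F A)"
  have nA: "\<eta> A \<in> Hom C A (?GF A)" and nB: "\<eta> B \<in> Hom C B (?GF B)"
    using n.component[OF A] n.component[OF B] by (simp_all add: comp_functor_def id_functor_def)
  obtain w where w: "w \<in> Hom C (?GF B) B" "w \<cdot>\<^bsub>C\<^esub> \<eta> B = Idt C B" "\<eta> B \<cdot>\<^bsub>C\<^esub> w = Idt C (?GF B)"
    by (rule F.C.is_isoE[OF n.component_iso[OF B] nB])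
  have Gf: "FArr G f \<in> Hom C (?GF A) (?GF B)" by (rule G.FArr_Hom[OF f])
  define v where "v = w \<cdot>\<^bsub>C\<^esub> (FArr G f \<cdot>\<^bsub>C\<^esub> \<eta> A)"
  have v: "v \<in> Hom C A B" unfolding v_def by (intro F.C.Cmp_Hom[OF _ w(1)] F.C.Cmp_Hom[OF nA Gf])
  have Fv: "FArr F v \<in> Hom D (FObj F A) (FObj F B)" by (rule F.FArr_Hom[OF v])
  have GFv: "FArr G (FArr F v) \<in> Hom C (?GF A) (?GF B)" by (rule G.FArr_Hom[OF Fv])
  have "FArr G (FArr F v) \<cdot>\<^bsub>C\<^esub> \<eta> A = \<eta> B \<cdot>\<^bsub>C\<^esub> v"
    using n.naturality[OF v] by (simp add: comp_functor_def id_functor_def)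
  also have "\<dots> = FArr G f \<cdot>\<^bsub>C\<^esub> \<eta> A"
    unfolding v_def using F.C.Cmp_rewrite[OF w(3), of "FArr G f \<cdot>\<^bsub>C\<^esub> \<eta> A"] w nA nB Gf
    by (simp add: Hom_iff)
  finally have G_eq: "FArr G (FArr F v) = FArr G f"
    using F.C.iso_cancel_right[OF n.component_iso[OF A]] nA GFv Gf by (simp add: Hom_iff)
  have FA: "FObj F A \<in> Obj D" by (rule F.FObj_Obj[OF A])
  have eA: "\<epsilon> (FObj F A) \<in> Hom D (FObj F (?GF A)) (FObj F A)"
    using e.component[OF FA] by (simp add: comp_functor_def id_functor_def)
  have "FArr F v \<cdot>\<^bsub>D\<^esub> \<epsilon> (FObj F A) = f \<cdot>\<^bsub>D\<^esub> \<epsilon> (FObj F A)"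
    using e.naturality[OF Fv] e.naturality[OF f] G_eq
    by (simp add: comp_functor_def id_functor_def)
  then have "FArr F v = f"
    using F.D.iso_cancel_right[OF e.component_iso[OF FA]] eA Fv f by (simp add: Hom_iff)
  with v that show thesis by blast
qed

text \<open>An isomorphism of categories \<open>P : D \<rightarrow> E\<close> with inverse \<open>Q\<close> turns a quasi-inverse \<open>G\<close> of \<open>F\<close>
  into the quasi-inverse \<open>G Q\<close> of \<open>P F\<close>, with the same unit and with counit \<open>P \<epsilon> Q\<close>. The functor \<open>F'\<close> only has to
  agree with \<open>P F\<close> on the carriers, because values elsewhere are arbitrary.\<close>

lemma equivalence_transport:
  assumes equiv: "equivalence C D F"
    and P: "cat_functor D E P" and Q: "cat_functor E D Q"
    and QP: "\<And>X. X \<in> Obj D \<Longrightarrow> FObj Q (FObj P X) = X"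
      "\<And>f. f \<in> Arr D \<Longrightarrow> FArr Q (FArr P f) = f"
    and PQ: "\<And>X. X \<in> Obj E \<Longrightarrow> FObj P (FObj Q X) = X"
      "\<And>f. f \<in> Arr E \<Longrightarrow> FArr P (FArr Q f) = f"
    and F': "\<And>A. A \<in> Obj C \<Longrightarrow> FObj F' A = FObj P (FObj F A)"
      "\<And>f. f \<in> Arr C \<Longrightarrow> FArr F' f = FArr P (FArr F f)"
  shows "equivalence C E F'"
proof -
  obtain G \<eta> \<epsilon> where F: "cat_functor C D F" and G: "cat_functor D C (G :: (_, _, _, _) cat_functor)"
      and n: "nat_iso C C id_functor (comp_functor G F) \<eta>"
      and e: "nat_iso D D (comp_functor F G) id_functor \<epsilon>"
    using equiv by (auto simp: equivalence_def)
  interpret F: cat_functor C D F by fact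
  interpret G: cat_functor D C G by fact
  interpret P: cat_functor D E P by fact
  interpret Q: cat_functor E D Q by fact
  interpret n: nat_iso C C id_functor "comp_functor G F" \<eta> by fact
  interpret e: nat_iso D D "comp_functor F G" id_functor \<epsilon> by fact
  have F'_functor: "cat_functor C E F'"
    by (rule cat_functor_cong[OF cat_functor_comp[OF F P]]) (simp_all add: comp_functor_def F')
  have G'_functor: "cat_functor E C (comp_functor G Q)"
    by (rule cat_functor_comp[OF Q G])
  interpret F': cat_functor C E F' by fact
  interpret GF': cat_functor C C "comp_functor (comp_functor G Q) F'"
    by (rule cat_functor_comp[OF F'_functor G'_functor])
  interpret FG': cat_functor E E "comp_functor F' (comp_functor G Q)"
    by (rule cat_functor_comp[OF G'_functor F'_functor])
  interpret idE: cat_functor E E id_functor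
    by unfold_locales (simp_all add: id_functor_def)
  have "nat_iso C C id_functor (comp_functor (comp_functor G Q) F') \<eta>"
  proof
    fix A assume A: "A \<in> Obj C"
    show "\<eta> A \<in> Hom C (FObj id_functor A) (FObj (comp_functor (comp_functor G Q) F') A)"
      using n.component[OF A] A
      by (simp add: comp_functor_def id_functor_def F' QP F.FObj_Obj)
    show "is_iso C (\<eta> A)" by (rule n.component_iso[OF A])
  next
    fix f A B assume f: "f \<in> Hom C A B"
    then have "f \<in> Arr C" by (simp add: Hom_iff)
    then show "\<eta> B \<cdot>\<^bsub>C\<^esub> FArr id_functor f
        = FArr (comp_functor (comp_functor G Q) F') f \<cdot>\<^bsub>C\<^esub> \<eta> A"
      using n.naturality[OF f]
      by (simp add: comp_functor_def id_functor_def F' QP F.FArr_arr)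
  qed
  moreover have "nat_iso E E (comp_functor F' (comp_functor G Q)) id_functor
      (\<lambda>X. FArr P (\<epsilon> (FObj Q X)))"
  proof
    fix X assume X: "X \<in> Obj E"
    note QX = Q.FObj_Obj[OF X]
    show "FArr P (\<epsilon> (FObj Q X))
        \<in> Hom E (FObj (comp_functor F' (comp_functor G Q)) X) (FObj id_functor X)"
      using P.FArr_Hom[OF e.component[OF QX]] X
      by (simp add: comp_functor_def id_functor_def F' PQ G.FObj_Obj QX)
    show "is_iso E (FArr P (\<epsilon> (FObj Q X)))"
      by (rule P.FArr_is_iso[OF e.component_iso[OF QX]])
  next
    fix f X Y assume f: "f \<in> Hom E X Y"
    then have fA: "f \<in> Arr E" and X: "X \<in> Obj E" and Y: "Y \<in> Obj E"
      using P.D.Dom_Obj P.D.Cod_Obj by (auto simp: Hom_iff)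
    note QX = Q.FObj_Obj[OF X] and QY = Q.FObj_Obj[OF Y] and Qf = Q.FArr_Hom[OF f]
    let ?q = "FArr Q f"
    have eX: "\<epsilon> (FObj Q X) \<in> Hom D (FObj F (FObj G (FObj Q X))) (FObj Q X)"
      and eY: "\<epsilon> (FObj Q Y) \<in> Hom D (FObj F (FObj G (FObj Q Y))) (FObj Q Y)"
      using e.component[OF QX] e.component[OF QY]
      by (simp_all add: comp_functor_def id_functor_def)
    have "FArr P (\<epsilon> (FObj Q Y)) \<cdot>\<^bsub>E\<^esub> FArr P (FArr F (FArr G ?q))
        = FArr P (?q \<cdot>\<^bsub>D\<^esub> \<epsilon> (FObj Q X))"
      using e.naturality[OF Qf] P.FArr_Cmp[OF F.FArr_Hom[OF G.FArr_Hom[OF Qf]] eY]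
      by (simp add: comp_functor_def id_functor_def)
    also have "\<dots> = f \<cdot>\<^bsub>E\<^esub> FArr P (\<epsilon> (FObj Q X))"
      using P.FArr_Cmp[OF eX Qf] PQ(2)[OF fA] by simp
    finally show "FArr P (\<epsilon> (FObj Q Y)) \<cdot>\<^bsub>E\<^esub> FArr (comp_functor F' (comp_functor G Q)) f
        = FArr id_functor f \<cdot>\<^bsub>E\<^esub> FArr P (\<epsilon> (FObj Q X))"
      using fA by (simp add: comp_functor_def id_functor_def F' G.FArr_arr Q.FArr_arr)
  qed
  ultimately show ?thesis
    using F'_functor G'_functor unfolding equivalence_def by blast
qed

lemma (in category) structured_category_category:
  assumes U: "\<And>X. X \<in> S \<Longrightarrow> U X \<in> Obj C"
    and P_Idt: "\<And>X. X \<in> S \<Longrightarrow> P X (Idt C (U X)) X"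
    and P_Cmp: "\<And>X Y Z f g. \<lbrakk>X \<in> S; Y \<in> S; Z \<in> S; f \<in> Hom C (U X) (U Y); g \<in> Hom C (U Y) (U Z);
      P X f Y; P Y g Z\<rbrakk> \<Longrightarrow> P X (g \<cdot> f) Z"
  shows "category (structured_category C S U P)"
proof
  let ?D = "structured_category C S U P"
  fix f g A B E assume "f \<in> Hom ?D A B" "g \<in> Hom ?D B E"
  then show "g \<cdot>\<^bsub>?D\<^esub> f \<in> Hom ?D A E"
    by (auto simp: Hom_iff structured_category_def intro: P_Cmp)
qed (auto simp: Hom_iff structured_category_def U P_Idt)

lemma structured_category_Hom:
  "F \<in> Hom (structured_category C S U P) X Y \<longleftrightarrow>
    (\<exists>f. F = (X, f, Y) \<and> X \<in> S \<and> Y \<in> S \<and> f \<in> Hom C (U X) (U Y) \<and> P X f Y)"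
  by (cases F) (auto simp: structured_category_def Hom_iff)

section \<open>Calculus of opmonoidal monads\<close>

context strict_monoidal_category
begin

lemma TArr_arr [simp]:
  assumes "f \<in> Arr V" "g \<in> Arr V"
  shows "f \<otimes>\<^sub>a g \<in> Arr V" "Dom V (f \<otimes>\<^sub>a g) = Dom V f \<otimes> Dom V g"
    "Cod V (f \<otimes>\<^sub>a g) = Cod V f \<otimes> Cod V g"
  using TArr_Hom[OF Arr_Hom[OF assms(1)] Arr_Hom[OF assms(2)]] by (simp_all add: Hom_iff)

lemma interchange:
  "\<lbrakk>f \<in> Arr V; g \<in> Arr V; f' \<in> Arr V; g' \<in> Arr V; Dom V g = Cod V f; Dom V g' = Cod V f'\<rbrakk>
    \<Longrightarrow> (g \<otimes>\<^sub>a g') \<cdot> (f \<otimes>\<^sub>a f') = (g \<cdot> f) \<otimes>\<^sub>a (g' \<cdot> f')"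
  using TArr_Cmp[of f _ _ g _ f' _ _ g'] by (simp add: Hom_iff)

lemma interchange_Cmp:
  "\<lbrakk>f \<in> Arr V; g \<in> Arr V; f' \<in> Arr V; g' \<in> Arr V; Dom V g = Cod V f; Dom V g' = Cod V f';
    x \<in> Arr V; Cod V x = Dom V f \<otimes> Dom V f'\<rbrakk>
    \<Longrightarrow> (g \<otimes>\<^sub>a g') \<cdot> ((f \<otimes>\<^sub>a f') \<cdot> x) = ((g \<cdot> f) \<otimes>\<^sub>a (g' \<cdot> f')) \<cdot> x"
  by (rule Cmp_rewrite[OF interchange]) (simp_all)

lemmas tensor_objects [simp] =
  Dom_Obj Cod_Obj UnitObj_Obj TObj_Obj TObj_assoc TObj_I_left TObj_I_right
  TArr_I_left TArr_I_right TArr_assoc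

end

context opmonoidal_monad
begin

lemma T_Obj [simp]: "A \<in> Obj V \<Longrightarrow> FObj T A \<in> Obj V"
  using T_functor by (rule cat_functor.FObj_Obj)

lemma T_arr [simp]:
  assumes "f \<in> Arr V"
  shows "FArr T f \<in> Arr V" "Dom V (FArr T f) = FObj T (Dom V f)"
    "Cod V (FArr T f) = FObj T (Cod V f)"
  using cat_functor.FArr_arr[OF T_functor assms] by simp_all

lemma T_Idt [simp]: "A \<in> Obj V \<Longrightarrow> FArr T (Idt V A) = Idt V (FObj T A)"
  using T_functor by (rule cat_functor.FArr_Idt)

lemma T_Cmp [simp]:
  "\<lbrakk>f \<in> Arr V; g \<in> Arr V; Dom V g = Cod V f\<rbrakk> \<Longrightarrow> FArr T (g \<cdot> f) = FArr T g \<cdot> FArr T f"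
  by (rule cat_functor.FArr_Cmp_arr[OF T_functor])

lemma mult_arr [simp]:
  assumes "A \<in> Obj V"
  shows "mult T A \<in> Arr V" "Dom V (mult T A) = FObj T (FObj T A)" "Cod V (mult T A) = FObj T A"
  using nat_trans.component[OF mult_nat assms] by (simp_all add: Hom_iff comp_functor_def)

lemma unit_arr [simp]:
  assumes "A \<in> Obj V"
  shows "unit T A \<in> Arr V" "Dom V (unit T A) = A" "Cod V (unit T A) = FObj T A"
  using nat_trans.component[OF unit_nat assms] by (simp_all add: Hom_iff id_functor_def)

lemma mult_natural:
  "f \<in> Hom V A B \<Longrightarrow> mult T B \<cdot> FArr T (FArr T f) = FArr T f \<cdot> mult T A"
  using nat_trans.naturality[OF mult_nat] by (simp add: comp_functor_def)

lemma unit_natural: "f \<in> Hom V A B \<Longrightarrow> unit T B \<cdot> f = FArr T f \<cdot> unit T A"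
  using nat_trans.naturality[OF unit_nat] by (simp add: id_functor_def)

lemma chi_arr [simp]:
  assumes "A \<in> Obj V" "B \<in> Obj V"
  shows "chi T A B \<in> Arr V" "Dom V (chi T A B) = FObj T (A \<otimes> B)"
    "Cod V (chi T A B) = FObj T A \<otimes> FObj T B"
  using chi_Hom[OF assms] by (simp_all add: Hom_iff)

lemma theta_arr [simp]:
  "theta T \<in> Arr V" "Dom V (theta T) = FObj T \<I>" "Cod V (theta T) = \<I>"
  using theta_Hom by (simp_all add: Hom_iff)

text \<open>The tensor product is strict, so \<open>T (f \<otimes> I)\<close> is \<open>T f\<close>.\<close>

lemma chi_natural_I:
  assumes "f \<in> Hom V A B"
  shows "chi T B \<I> \<cdot> FArr T f = (FArr T f \<otimes>\<^sub>a Idt V (FObj T \<I>)) \<cdot> chi T A \<I>"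
  using chi_nat[OF assms Idt_Hom[OF UnitObj_Obj]] assms by (simp add: Hom_iff)

abbreviation TI :: 'o where "TI \<equiv> FObj T \<I>"
abbreviation idTI :: 'a where "idTI \<equiv> Idt V TI"

section \<open>The canonical map from the free module to the cofree Hopf module\<close>

text \<open>For a module \<open>(A, h)\<close> this is a morphism \<open>T A \<rightarrow> A \<otimes> T I\<close>; for the free module \<open>(T A, m\<^sub>A)\<close> it
  is the morphism that the Galois condition requires to be invertible.\<close>

definition can :: "'o \<Rightarrow> 'a \<Rightarrow> 'a" where
  "can A h = (h \<otimes>\<^sub>a idTI) \<cdot> chi T A \<I>"

lemma module_arr:
  assumes "is_module V T A h"
  shows "A \<in> Obj V" "h \<in> Arr V" "Dom V h = FObj T A" "Cod V h = A"
  using assms by (simp_all add: is_module_def Hom_iff)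

lemma module_eqs:
  assumes "is_module V T A h"
  shows "h \<cdot> mult T A = h \<cdot> FArr T h" "h \<cdot> unit T A = Idt V A"
  using assms by (simp_all add: is_module_def)

lemma free_is_module:
  assumes "A \<in> Obj V"
  shows "is_module V T (FObj T A) (mult T A)"
  using assms mult_assoc[OF assms] mult_unit_left[OF assms] by (simp add: is_module_def Hom_iff)

lemma can_arr:
  assumes "is_module V T A h"
  shows "can A h \<in> Arr V" "Dom V (can A h) = FObj T A" "Cod V (can A h) = A \<otimes> TI"
  using module_arr[OF assms] by (simp_all add: can_def)

lemma can_free: "can (FObj T A) (mult T A) = (mult T A \<otimes>\<^sub>a idTI) \<cdot> chi T (FObj T A) \<I>"
  by (simp add: can_def)

text \<open>A module map \<open>f : (A, h) \<rightarrow> (B, k)\<close> moves past both factors of the canonical map, by naturality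
  of \<open>\<chi>\<close> and by \<open>k \<cdot> T f = f \<cdot> h\<close>.\<close>

lemma can_natural:
  assumes A: "is_module V T A h" and B: "is_module V T B k"
    and f: "f \<in> Hom V A B" "f \<cdot> h = k \<cdot> FArr T f"
  shows "can B k \<cdot> FArr T f = (f \<otimes>\<^sub>a idTI) \<cdot> can A h"
proof -
  have [simp]: "f \<in> Arr V" "Dom V f = A" "Cod V f = B" using f by (simp_all add: Hom_iff)
  note [simp] = module_arr[OF A] module_arr[OF B]
  have "can B k \<cdot> FArr T f = (k \<otimes>\<^sub>a idTI) \<cdot> (FArr T f \<otimes>\<^sub>a idTI) \<cdot> chi T A \<I>"
    by (simp add: can_def chi_natural_I[OF f(1)])
  also have "\<dots> = (f \<otimes>\<^sub>a idTI) \<cdot> can A h"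
    by (simp add: can_def interchange_Cmp f(2))
  finally show ?thesis .
qed

text \<open>This and the next two lemmas say that the canonical map is a morphism of Hopf modules from
  \<open>K A\<close> to the cofree Hopf module \<open>A \<otimes> T I\<close> and that it corresponds there to the module map \<open>h\<close>. With naturality they
  also make the canonical maps a morphism of comonads.\<close>

lemma can_counit:
  assumes A: "is_module V T A h"
  shows "(Idt V A \<otimes>\<^sub>a theta T) \<cdot> can A h = h"
proof -
  note [simp] = module_arr[OF A]
  have "(Idt V A \<otimes>\<^sub>a theta T) \<cdot> can A h
      = (h \<otimes>\<^sub>a Idt V \<I>) \<cdot> ((Idt V (FObj T A) \<otimes>\<^sub>a theta T) \<cdot> chi T A \<I>)"
    by (simp add: can_def interchange_Cmp del: TArr_I_right)
  then show ?thesis by (simp add: chi_counit_right)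
qed

lemma can_module_map:
  assumes A: "is_module V T A h"
  shows "can A h \<cdot> mult T A = (h \<otimes>\<^sub>a mult T \<I>) \<cdot> (chi T A TI \<cdot> FArr T (can A h))"
proof -
  note [simp] = module_arr[OF A]
  have hA: "h \<in> Hom V (FObj T A) A" by (simp add: Hom_iff)
  have "can A h \<cdot> mult T A = (h \<otimes>\<^sub>a idTI) \<cdot> ((mult T A \<otimes>\<^sub>a mult T \<I>) \<cdot>
      (chi T (FObj T A) TI \<cdot> FArr T (chi T A \<I>)))"
    using chi_mult[of A \<I>] by (simp add: can_def)
  also have "\<dots> = (h \<otimes>\<^sub>a mult T \<I>) \<cdot>
      ((FArr T h \<otimes>\<^sub>a Idt V (FObj T TI)) \<cdot> (chi T (FObj T A) TI \<cdot> FArr T (chi T A \<I>)))"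
    by (simp add: interchange_Cmp module_eqs[OF A])
  also have "\<dots> = (h \<otimes>\<^sub>a mult T \<I>) \<cdot>
      (chi T A TI \<cdot> (FArr T (h \<otimes>\<^sub>a idTI) \<cdot> FArr T (chi T A \<I>)))"
    using chi_nat[OF hA Idt_Hom[of TI]]
      Cmp_rewrite[OF chi_nat[OF hA Idt_Hom[of TI]], of "FArr T (chi T A \<I>)"] by simp
  finally show ?thesis by (simp add: can_def)
qed

lemma can_coassoc:
  assumes A: "is_module V T A h"
  shows "(Idt V A \<otimes>\<^sub>a chi T \<I> \<I>) \<cdot> can A h = (can A h \<otimes>\<^sub>a idTI) \<cdot> chi T A \<I>"
proof -
  note [simp] = module_arr[OF A]
  have "(Idt V A \<otimes>\<^sub>a chi T \<I> \<I>) \<cdot> can A h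
      = (h \<otimes>\<^sub>a (idTI \<otimes>\<^sub>a idTI)) \<cdot> ((Idt V (FObj T A) \<otimes>\<^sub>a chi T \<I> \<I>) \<cdot> chi T A \<I>)"
    by (simp add: can_def interchange_Cmp TArr_Idt del: TArr_assoc)
  also have "\<dots> = ((h \<otimes>\<^sub>a idTI) \<otimes>\<^sub>a idTI) \<cdot> ((chi T A \<I> \<otimes>\<^sub>a idTI) \<cdot> chi T A \<I>)"
    using chi_coassoc[of A \<I> \<I>] by simp
  finally show ?thesis
    by (simp add: can_def interchange_Cmp del: TArr_assoc)
qed

text \<open>This identifies \<open>K\<close> with the comparison functor followed by composition with canonical maps.\<close>

lemma can_free_T_unit:
  assumes [simp]: "A \<in> Obj V"
  shows "can (FObj T A) (mult T A) \<cdot> FArr T (unit T A) = chi T A \<I>"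
proof -
  have "unit T A \<in> Hom V A (FObj T A)" by (simp add: Hom_iff)
  then show ?thesis
    by (simp add: can_def chi_natural_I interchange_Cmp mult_unit_right TArr_Idt)
qed

lemma can_precompose:
  assumes "is_module V T A h" "f \<in> Hom V B A"
  shows "can A h \<cdot> FArr T f = ((h \<cdot> FArr T f) \<otimes>\<^sub>a idTI) \<cdot> chi T B \<I>"
proof -
  note [simp] = module_arr[OF assms(1)]
  have [simp]: "f \<in> Arr V" "Dom V f = B" "Cod V f = A" "B \<in> Obj V"
    using assms(2) Dom_Obj[of f] by (auto simp: Hom_iff)
  show ?thesis by (simp add: can_def chi_natural_I[OF assms(2)] interchange_Cmp)
qed

section \<open>The Galois condition extends from free modules to all modules\<close>

text \<open>
  Let \<open>\<beta>\<^sub>A\<close> be the canonical map of the free module \<open>(T A, m\<^sub>A)\<close>. For any module \<open>(A, h)\<close> the arrow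
  \<open>T h \<cdot> \<beta>\<^sub>A\<inverse> \<cdot> (e\<^sub>A \<otimes> T I)\<close> is a right inverse of the canonical map by naturality along the module map
  \<open>h : T A \<rightarrow> A\<close>. For the free module itself the right inverse has to be \<open>\<beta>\<^sub>A\<inverse>\<close>; pulling this
  identity along the split epimorphism \<open>T h\<close> shows that the arrow is a left inverse as well.
\<close>

lemma Galois_can_iso:
  assumes G: "Galois V T" and A: "is_module V T A h"
  shows "is_iso V (can A h)"
proof -
  note [simp] = module_arr[OF A] can_arr[OF A]
  have iso: "is_iso V (can (FObj T B) (mult T B))" if "B \<in> Obj V" for B
    using G that by (simp add: Galois_def can_free)
  have free: "is_module V T (FObj T B) (mult T B)" if "B \<in> Obj V" for B
    by (rule free_is_module[OF that])
  \<comment> \<open>A choice of \<open>\<beta>\<^sub>B\<inverse>\<close> for all \<open>B\<close>: besides \<open>\<beta>\<^sub>A\<inverse>\<close>, also \<open>\<beta>\<inverse>\<close> at \<open>T A\<close> occurs below.\<close>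
  define b where "b = (\<lambda>B. SOME g. g \<in> Hom V (FObj T B \<otimes> TI) (FObj T (FObj T B)) \<and>
    g \<cdot> can (FObj T B) (mult T B) = Idt V (FObj T (FObj T B)) \<and>
    can (FObj T B) (mult T B) \<cdot> g = Idt V (FObj T B \<otimes> TI))"
  have b: "b B \<in> Hom V (FObj T B \<otimes> TI) (FObj T (FObj T B)) \<and>
    b B \<cdot> can (FObj T B) (mult T B) = Idt V (FObj T (FObj T B)) \<and>
    can (FObj T B) (mult T B) \<cdot> b B = Idt V (FObj T B \<otimes> TI)" if B: "B \<in> Obj V" for B
    unfolding b_def
  proof (rule someI_ex)
    obtain g where "g \<in> Hom V (FObj T B \<otimes> TI) (FObj T (FObj T B))"
      "g \<cdot> can (FObj T B) (mult T B) = Idt V (FObj T (FObj T B))"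
      "can (FObj T B) (mult T B) \<cdot> g = Idt V (FObj T B \<otimes> TI)"
      by (rule is_isoE[OF iso[OF B], of "FObj T (FObj T B)" "FObj T B \<otimes> TI"])
        (use can_arr[OF free[OF B]] in \<open>auto simp: Hom_iff\<close>)
    then show "\<exists>g. g \<in> Hom V (FObj T B \<otimes> TI) (FObj T (FObj T B)) \<and>
      g \<cdot> can (FObj T B) (mult T B) = Idt V (FObj T (FObj T B)) \<and>
      can (FObj T B) (mult T B) \<cdot> g = Idt V (FObj T B \<otimes> TI)" by blast
  qed
  have b_arr [simp]: "b B \<in> Arr V" "Dom V (b B) = FObj T B \<otimes> TI" "Cod V (b B) = FObj T (FObj T B)"
    if "B \<in> Obj V" for B
    using b[OF that] by (simp_all add: Hom_iff)
  define r where "r = (\<lambda>B k. FArr T k \<cdot> (b B \<cdot> (unit T B \<otimes>\<^sub>a idTI)))"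
  have r_arr: "r B k \<in> Hom V (B \<otimes> TI) (FObj T B)" if "is_module V T B k" for B k
    using module_arr[OF that] by (simp add: r_def Hom_iff)
  have right: "can B k \<cdot> r B k = Idt V (B \<otimes> TI)" if B: "is_module V T B k" for B k
  proof -
    note [simp] = module_arr[OF B] can_arr[OF B]
    note [simp] = can_arr[OF free[OF \<open>B \<in> Obj V\<close>]]
    have k: "k \<in> Hom V (FObj T B) B" "k \<cdot> mult T B = k \<cdot> FArr T k"
      using module_eqs[OF B] by (simp_all add: Hom_iff)
    have "can B k \<cdot> r B k = (k \<otimes>\<^sub>a idTI) \<cdot> (can (FObj T B) (mult T B) \<cdot> (b B \<cdot> (unit T B \<otimes>\<^sub>a idTI)))"
      using Cmp_rewrite[OF can_natural[OF free B k], of "b B \<cdot> (unit T B \<otimes>\<^sub>a idTI)"]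
      by (simp add: r_def)
    also have "can (FObj T B) (mult T B) \<cdot> (b B \<cdot> (unit T B \<otimes>\<^sub>a idTI)) = unit T B \<otimes>\<^sub>a idTI"
      using Cmp_rewrite[of "can (FObj T B) (mult T B)" "b B" _ "unit T B \<otimes>\<^sub>a idTI"] b[of B] by simp
    also have "(k \<otimes>\<^sub>a idTI) \<cdot> (unit T B \<otimes>\<^sub>a idTI) = Idt V (B \<otimes> TI)"
      by (simp add: interchange module_eqs[OF B] TArr_Idt)
    finally show ?thesis .
  qed
  note F = free[OF \<open>A \<in> Obj V\<close>]
  let ?\<beta> = "can (FObj T A) (mult T A)"
  note [simp] = can_arr[OF F] can_arr[OF free[of "FObj T A"]]
  have h: "h \<in> Hom V (FObj T A) A" by (simp add: Hom_iff)
  have Th: "FArr T h \<in> Hom V (FObj T (FObj T A)) (FObj T A)" by (simp add: Hom_iff)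
  have b_eqs: "b A \<cdot> ?\<beta> = Idt V (FObj T (FObj T A))" "?\<beta> \<cdot> b A = Idt V (FObj T A \<otimes> TI)"
    using b[of A] by simp_all
  have bT_eqs: "can (FObj T (FObj T A)) (mult T (FObj T A)) \<cdot> b (FObj T A)
      = Idt V (FObj T (FObj T A) \<otimes> TI)"
    using b[of "FObj T A"] by simp
  have r_free: "r (FObj T A) (mult T A) = b A"
    using iso_cancel_left[OF iso[OF \<open>A \<in> Obj V\<close>], of "r (FObj T A) (mult T A)" "b A"]
      right[OF F] b_eqs r_arr[OF F] by (simp add: Hom_iff)
  \<comment> \<open>Naturality of \<open>\<beta>\<close> along \<open>T h\<close>, transposed to the inverses.\<close>
  have b_nat: "b A \<cdot> (FArr T h \<otimes>\<^sub>a idTI) = FArr T (FArr T h) \<cdot> b (FObj T A)"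
  proof (rule iso_cancel_left[OF iso[OF \<open>A \<in> Obj V\<close>]])
    have "?\<beta> \<cdot> (FArr T (FArr T h) \<cdot> b (FObj T A))
        = (FArr T h \<otimes>\<^sub>a idTI) \<cdot> (can (FObj T (FObj T A)) (mult T (FObj T A)) \<cdot> b (FObj T A))"
      using Cmp_rewrite[OF can_natural[OF free[of "FObj T A"] F Th], of "b (FObj T A)"]
      by (simp add: mult_natural[OF h])
    also have "\<dots> = FArr T h \<otimes>\<^sub>a idTI" by (simp add: bT_eqs)
    also have "\<dots> = ?\<beta> \<cdot> (b A \<cdot> (FArr T h \<otimes>\<^sub>a idTI))"
      using Cmp_rewrite[OF b_eqs(2), of "FArr T h \<otimes>\<^sub>a idTI"] by simp
    finally show "?\<beta> \<cdot> (b A \<cdot> (FArr T h \<otimes>\<^sub>a idTI)) = ?\<beta> \<cdot> (FArr T (FArr T h) \<cdot> b (FObj T A))"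
      by simp
  qed simp_all
  \<comment> \<open>The unit \<open>e\<^sub>A\<close> is not a module map in general. Precomposed with \<open>h\<close> it becomes \<open>T h \<cdot> e\<close> at \<open>T A\<close>, and \<open>T h\<close> is one.\<close>
  have "r A h \<cdot> (can A h \<cdot> FArr T h) = FArr T h"
  proof -
    let ?e = "unit T (FObj T A) \<otimes>\<^sub>a idTI"
    have "r A h \<cdot> (can A h \<cdot> FArr T h) = r A h \<cdot> ((h \<otimes>\<^sub>a idTI) \<cdot> ?\<beta>)"
      by (simp add: can_natural[OF F A h module_eqs(1)[OF A]])
    also have "\<dots> = FArr T h \<cdot> (b A \<cdot> (((unit T A \<cdot> h) \<otimes>\<^sub>a idTI) \<cdot> ?\<beta>))"
      by (simp add: r_def interchange_Cmp)
    also have "\<dots> = FArr T h \<cdot> (b A \<cdot> ((FArr T h \<otimes>\<^sub>a idTI) \<cdot> (?e \<cdot> ?\<beta>)))"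
      by (simp add: unit_natural[OF h] interchange_Cmp)
    also have "\<dots> = FArr T h \<cdot> (FArr T (FArr T h) \<cdot> (b (FObj T A) \<cdot> (?e \<cdot> ?\<beta>)))"
      using Cmp_rewrite[OF b_nat, of "?e \<cdot> ?\<beta>"] by simp
    also have "\<dots> = FArr T (h \<cdot> FArr T h) \<cdot> (b (FObj T A) \<cdot> (?e \<cdot> ?\<beta>))"
      by simp
    also have "\<dots> = FArr T h \<cdot> (r (FObj T A) (mult T A) \<cdot> ?\<beta>)"
      by (subst module_eqs(1)[OF A, symmetric]) (simp add: r_def)
    also have "\<dots> = FArr T h" by (simp add: r_free b_eqs)
    finally show ?thesis .
  qed
  then have "(r A h \<cdot> (can A h \<cdot> FArr T h)) \<cdot> FArr T (unit T A) = FArr T h \<cdot> FArr T (unit T A)"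
    by simp
  moreover have "FArr T h \<cdot> FArr T (unit T A) = Idt V (FObj T A)"
    using T_Cmp[of "unit T A" h] by (simp add: module_eqs[OF A])
  ultimately have "r A h \<cdot> can A h = Idt V (FObj T A)"
    using r_arr[OF A] by (simp add: Hom_iff)
  then show ?thesis
    using right[OF A] r_arr[OF A]
    by (intro is_isoI[of _ "FObj T A" "A \<otimes> TI" "r A h"]) (simp_all add: Hom_iff)
qed

section \<open>Hopf modules\<close>

definition is_Hopf_module :: "'o \<Rightarrow> 'a \<Rightarrow> 'a \<Rightarrow> bool" where
  "is_Hopf_module A h r \<longleftrightarrow> is_module V T A h \<and> r \<in> Hom V A (A \<otimes> TI) \<and>
    (r \<otimes>\<^sub>a idTI) \<cdot> r = (Idt V A \<otimes>\<^sub>a chi T \<I> \<I>) \<cdot> r \<and>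
    (Idt V A \<otimes>\<^sub>a theta T) \<cdot> r = Idt V A \<and>
    r \<cdot> h = (h \<otimes>\<^sub>a mult T \<I>) \<cdot> (chi T A TI \<cdot> FArr T r)"

definition is_Hopf_map :: "'a \<Rightarrow> 'a \<Rightarrow> 'a \<Rightarrow> 'a \<Rightarrow> 'a \<Rightarrow> bool" where
  "is_Hopf_map h r f k s \<longleftrightarrow> f \<cdot> h = k \<cdot> FArr T f \<and> s \<cdot> f = (f \<otimes>\<^sub>a idTI) \<cdot> r"

abbreviation Hopf where "Hopf \<equiv> Hopf_module_category V T"

lemma Hopf_structured:
  "Hopf = structured_category V {(A, h, r). is_Hopf_module A h r} fst
    (\<lambda>(A, h, r) f (B, k, s). is_Hopf_map h r f k s)"
proof -
  have "is_module V T A h \<and> is_right_comodule V (TI_comonoid V T) A r \<and>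
      r \<cdot> h = (h \<otimes>\<^sub>a mult T \<I>) \<cdot> chi T A TI \<cdot> FArr T r \<longleftrightarrow> is_Hopf_module A h r" for A h r
    using module_arr[of A h]
    by (auto simp: is_right_comodule_def TI_comonoid_def is_Hopf_module_def Hom_iff)
  then show ?thesis
    by (simp add: Hopf_module_category_def TI_comonoid_def module_map_def comodule_map_def
        is_Hopf_map_def case_prod_unfold)
qed

lemma Hopf_Obj_iff: "(A, h, r) \<in> Obj Hopf \<longleftrightarrow> is_Hopf_module A h r"
  by (simp add: Hopf_structured structured_category_def)

lemma Hopf_Hom_iff:
  "F \<in> Hom Hopf (A, h, r) (B, k, s) \<longleftrightarrow> (\<exists>f. F = ((A, h, r), f, (B, k, s)) \<and>
    is_Hopf_module A h r \<and> is_Hopf_module B k s \<and> f \<in> Hom V A B \<and> is_Hopf_map h r f k s)"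
  by (auto simp: Hopf_structured structured_category_Hom)

lemma Hopf_Cmp: "(Y', g, Z) \<cdot>\<^bsub>Hopf\<^esub> (X, f, Y) = (X, g \<cdot> f, Z)"
  by (simp add: Hopf_structured structured_category_def)

lemma Hopf_Idt: "Idt Hopf (A, h, r) = ((A, h, r), Idt V A, (A, h, r))"
  by (simp add: Hopf_structured structured_category_def)

lemma Hopf_category: "category Hopf"
  unfolding Hopf_structured
proof (rule structured_category_category)
  fix X assume "X \<in> {(A, h, r). is_Hopf_module A h r}"
  then obtain A h r where X: "X = (A, h, r)" and H: "is_Hopf_module A h r" by auto
  then have M: "is_module V T A h" by (simp add: is_Hopf_module_def)
  note [simp] = module_arr[OF M]
  show "fst X \<in> Obj V" by (simp add: X)
  show "(\<lambda>(A, h, r) f (B, k, s). is_Hopf_map h r f k s) X (Idt V (fst X)) X"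
    using H by (simp add: X is_Hopf_map_def TArr_Idt is_Hopf_module_def Hom_iff)
next
  fix X Y Z f g
  assume XYZ: "X \<in> {(A, h, r). is_Hopf_module A h r}" "Y \<in> {(A, h, r). is_Hopf_module A h r}"
      "Z \<in> {(A, h, r). is_Hopf_module A h r}"
    and f: "f \<in> Hom V (fst X) (fst Y)" and g: "g \<in> Hom V (fst Y) (fst Z)"
    and Pf: "(\<lambda>(A, h, r) f (B, k, s). is_Hopf_map h r f k s) X f Y"
    and Pg: "(\<lambda>(A, h, r) f (B, k, s). is_Hopf_map h r f k s) Y g Z"
  obtain A h r B k s C l t where X: "X = (A, h, r)" and Y: "Y = (B, k, s)" and Z: "Z = (C, l, t)"
    by (cases X, cases Y, cases Z) auto
  from XYZ have H: "is_Hopf_module A h r" "is_Hopf_module B k s" "is_Hopf_module C l t"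
    by (simp_all add: X Y Z)
  then have M: "is_module V T A h" "is_module V T B k" "is_module V T C l"
      and [simp]: "r \<in> Arr V" "Dom V r = A" "Cod V r = A \<otimes> TI"
      "s \<in> Arr V" "Dom V s = B" "Cod V s = B \<otimes> TI" "t \<in> Arr V" "Dom V t = C" "Cod V t = C \<otimes> TI"
    by (simp_all add: is_Hopf_module_def Hom_iff)
  note [simp] = module_arr[OF M(1)] module_arr[OF M(2)] module_arr[OF M(3)]
  have [simp]: "f \<in> Arr V" "Dom V f = A" "Cod V f = B" "g \<in> Arr V" "Dom V g = B" "Cod V g = C"
    using f g by (simp_all add: Hom_iff X Y Z)
  have eqs: "f \<cdot> h = k \<cdot> FArr T f" "s \<cdot> f = (f \<otimes>\<^sub>a idTI) \<cdot> r"
      "g \<cdot> k = l \<cdot> FArr T g" "t \<cdot> g = (g \<otimes>\<^sub>a idTI) \<cdot> s"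
    using Pf Pg by (simp_all add: X Y Z is_Hopf_map_def)
  have "(g \<cdot> f) \<cdot> h = l \<cdot> FArr T (g \<cdot> f)"
    using Cmp_rewrite[OF eqs(3), of "FArr T f"] by (simp add: eqs(1))
  moreover have "t \<cdot> (g \<cdot> f) = ((g \<cdot> f) \<otimes>\<^sub>a idTI) \<cdot> r"
    using Cmp_rewrite[OF eqs(4), of f] by (simp add: eqs(2) interchange_Cmp)
  ultimately show "(\<lambda>(A, h, r) f (B, k, s). is_Hopf_map h r f k s) X (g \<cdot> f) Z"
    by (simp add: X Z is_Hopf_map_def)
qed

section \<open>If \<open>K\<close> is an equivalence, the canonical maps are invertible\<close>

definition cofree_action :: "'o \<Rightarrow> 'a \<Rightarrow> 'a" where
  "cofree_action A h = (h \<otimes>\<^sub>a mult T \<I>) \<cdot> chi T A TI"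

text \<open>The module axioms come from compatibility of \<open>\<chi>\<close> with the monad, the comodule axioms from the
  comonoid \<open>T I\<close>. The mixed axiom combines compatibility of the comultiplication \<open>\<chi>\<^sub>I\<^sub>,\<^sub>I\<close> with
  \<open>m\<^sub>I\<close>, coassociativity of \<open>\<chi>\<close> and its naturality.\<close>

lemma cofree_Hopf_module:
  assumes A: "is_module V T A h"
  shows "is_Hopf_module (A \<otimes> TI) (cofree_action A h) (Idt V A \<otimes>\<^sub>a chi T \<I> \<I>)"
proof -
  note [simp] = module_arr[OF A]
  let ?h = "cofree_action A h" and ?r = "Idt V A \<otimes>\<^sub>a chi T \<I> \<I>"
  have hA: "h \<in> Hom V (FObj T A) A" by (simp add: Hom_iff)
  have mI: "mult T \<I> \<in> Hom V (FObj T TI) TI" by (simp add: Hom_iff)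
  have h_arr [simp]: "?h \<in> Arr V" "Dom V ?h = FObj T (A \<otimes> TI)" "Cod V ?h = A \<otimes> TI"
    by (simp_all add: cofree_action_def)
  have mod_unit: "?h \<cdot> unit T (A \<otimes> TI) = Idt V (A \<otimes> TI)"
    by (simp add: cofree_action_def chi_unit interchange module_eqs[OF A] mult_unit_left TArr_Idt)
  have "?h \<cdot> mult T (A \<otimes> TI) = (h \<otimes>\<^sub>a mult T \<I>) \<cdot> ((mult T A \<otimes>\<^sub>a mult T TI) \<cdot>
      (chi T (FObj T A) (FObj T TI) \<cdot> FArr T (chi T A TI)))"
    by (simp add: cofree_action_def chi_mult)
  also have "\<dots> = (h \<otimes>\<^sub>a mult T \<I>) \<cdot> ((FArr T h \<otimes>\<^sub>a FArr T (mult T \<I>)) \<cdot>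
      (chi T (FObj T A) (FObj T TI) \<cdot> FArr T (chi T A TI)))"
    by (simp add: interchange_Cmp module_eqs[OF A] mult_assoc)
  also have "\<dots> = ?h \<cdot> FArr T ?h"
    using Cmp_rewrite[OF chi_nat[OF hA mI], of "FArr T (chi T A TI)"]
    by (simp add: cofree_action_def)
  finally have mod_mult: "?h \<cdot> mult T (A \<otimes> TI) = ?h \<cdot> FArr T ?h" .
  have "(?r \<otimes>\<^sub>a idTI) \<cdot> ?r = Idt V A \<otimes>\<^sub>a ((chi T \<I> \<I> \<otimes>\<^sub>a idTI) \<cdot> chi T \<I> \<I>)"
    by (simp add: interchange)
  also have "\<dots> = Idt V A \<otimes>\<^sub>a ((idTI \<otimes>\<^sub>a chi T \<I> \<I>) \<cdot> chi T \<I> \<I>)"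
    using chi_coassoc[of \<I> \<I> \<I>] by simp
  also have "\<dots> = ((Idt V A \<otimes>\<^sub>a idTI) \<otimes>\<^sub>a chi T \<I> \<I>) \<cdot> ?r"
    by (simp add: interchange)
  finally have coassoc: "(?r \<otimes>\<^sub>a idTI) \<cdot> ?r = (Idt V (A \<otimes> TI) \<otimes>\<^sub>a chi T \<I> \<I>) \<cdot> ?r"
    by (simp add: TArr_Idt del: TArr_assoc)
  have "((Idt V A \<otimes>\<^sub>a idTI) \<otimes>\<^sub>a theta T) \<cdot> ?r = Idt V A \<otimes>\<^sub>a ((idTI \<otimes>\<^sub>a theta T) \<cdot> chi T \<I> \<I>)"
    by (simp add: interchange)
  then have counit: "(Idt V (A \<otimes> TI) \<otimes>\<^sub>a theta T) \<cdot> ?r = Idt V (A \<otimes> TI)"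
    by (simp add: TArr_Idt chi_counit_right del: TArr_assoc)
  have T_chi: "chi T A (TI \<otimes> TI) \<cdot> FArr T ?r
      = (Idt V (FObj T A) \<otimes>\<^sub>a FArr T (chi T \<I> \<I>)) \<cdot> chi T A TI"
    using chi_nat[of "Idt V A" A A "chi T \<I> \<I>" TI "TI \<otimes> TI"] by (simp add: Hom_iff)
  have "?r \<cdot> ?h = (h \<otimes>\<^sub>a (chi T \<I> \<I> \<cdot> mult T \<I>)) \<cdot> chi T A TI"
    by (simp add: cofree_action_def interchange_Cmp)
  also have "chi T \<I> \<I> \<cdot> mult T \<I>
      = (mult T \<I> \<otimes>\<^sub>a mult T \<I>) \<cdot> (chi T TI TI \<cdot> FArr T (chi T \<I> \<I>))"
    using chi_mult[of \<I> \<I>] by simp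
  also have "(h \<otimes>\<^sub>a \<dots>) \<cdot> chi T A TI = (h \<otimes>\<^sub>a (mult T \<I> \<otimes>\<^sub>a mult T \<I>)) \<cdot>
      ((Idt V (FObj T A) \<otimes>\<^sub>a chi T TI TI) \<cdot>
        ((Idt V (FObj T A) \<otimes>\<^sub>a FArr T (chi T \<I> \<I>)) \<cdot> chi T A TI))"
    by (simp add: interchange_Cmp)
  also have "\<dots> = (h \<otimes>\<^sub>a (mult T \<I> \<otimes>\<^sub>a mult T \<I>)) \<cdot>
      ((Idt V (FObj T A) \<otimes>\<^sub>a chi T TI TI) \<cdot> (chi T A (TI \<otimes> TI) \<cdot> FArr T ?r))"
    by (simp only: T_chi)
  also have "\<dots> = ((h \<otimes>\<^sub>a mult T \<I>) \<otimes>\<^sub>a mult T \<I>) \<cdot>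
      ((chi T A TI \<otimes>\<^sub>a Idt V (FObj T TI)) \<cdot> (chi T (A \<otimes> TI) TI \<cdot> FArr T ?r))"
    using Cmp_rewrite[OF chi_coassoc[of A TI TI], of "FArr T ?r"] by simp
  also have "\<dots> = (?h \<otimes>\<^sub>a mult T \<I>) \<cdot> (chi T (A \<otimes> TI) TI \<cdot> FArr T ?r)"
    by (simp add: cofree_action_def interchange_Cmp del: TArr_assoc)
  finally have compat: "?r \<cdot> ?h = (?h \<otimes>\<^sub>a mult T \<I>) \<cdot> (chi T (A \<otimes> TI) TI \<cdot> FArr T ?r)" .
  show ?thesis
    using mod_unit mod_mult coassoc counit compat
    by (simp add: is_Hopf_module_def is_module_def Hom_iff)
qed

lemma cofree_counit_module_map:
  assumes A: "is_module V T A h"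
  shows "(Idt V A \<otimes>\<^sub>a theta T) \<cdot> cofree_action A h = h \<cdot> FArr T (Idt V A \<otimes>\<^sub>a theta T)"
proof -
  note [simp] = module_arr[OF A]
  let ?c = "Idt V A \<otimes>\<^sub>a theta T"
  have "?c \<cdot> cofree_action A h = (h \<otimes>\<^sub>a (theta T \<cdot> mult T \<I>)) \<cdot> chi T A TI"
    by (simp add: cofree_action_def interchange_Cmp)
  also have "\<dots> = (h \<otimes>\<^sub>a theta T) \<cdot> ((Idt V (FObj T A) \<otimes>\<^sub>a FArr T (theta T)) \<cdot> chi T A TI)"
    by (simp add: theta_mult interchange_Cmp)
  also have "\<dots> = (h \<otimes>\<^sub>a theta T) \<cdot> (chi T A \<I> \<cdot> FArr T ?c)"
    using chi_nat[of "Idt V A" A A "theta T" TI \<I>] by (simp add: Hom_iff)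
  also have "\<dots> = (h \<otimes>\<^sub>a Idt V \<I>) \<cdot>
      ((Idt V (FObj T A) \<otimes>\<^sub>a theta T) \<cdot> (chi T A \<I> \<cdot> FArr T ?c))"
    by (simp add: interchange_Cmp del: TArr_I_right)
  also have "\<dots> = h \<cdot> FArr T ?c"
    using Cmp_rewrite[OF chi_counit_right[of A], of "FArr T ?c"] by simp
  finally show ?thesis .
qed

text \<open>
  A Hopf module map \<open>K B \<rightarrow> A \<otimes> T I\<close> is recovered from its composite with the counit \<open>A \<otimes> \<theta>\<close>. This is the
  uniqueness half of cofreeness; it follows by applying \<open>A \<otimes> \<theta> \<otimes> T I\<close> to the colinearity of the map.
\<close>

lemma Hopf_map_to_cofree:
  assumes [simp]: "A \<in> Obj V" "B \<in> Obj V"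
    and s: "s \<in> Hom V (FObj T B) (A \<otimes> TI)"
    and colin: "(Idt V A \<otimes>\<^sub>a chi T \<I> \<I>) \<cdot> s = (s \<otimes>\<^sub>a idTI) \<cdot> chi T B \<I>"
  shows "(((Idt V A \<otimes>\<^sub>a theta T) \<cdot> s) \<otimes>\<^sub>a idTI) \<cdot> chi T B \<I> = s"
proof -
  have [simp]: "s \<in> Arr V" "Dom V s = FObj T B" "Cod V s = A \<otimes> TI"
    using s by (simp_all add: Hom_iff)
  have "(((Idt V A \<otimes>\<^sub>a theta T) \<cdot> s) \<otimes>\<^sub>a idTI) \<cdot> chi T B \<I>
      = ((Idt V A \<otimes>\<^sub>a theta T) \<otimes>\<^sub>a idTI) \<cdot> ((s \<otimes>\<^sub>a idTI) \<cdot> chi T B \<I>)"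
    by (simp add: interchange_Cmp del: TArr_assoc)
  also have "\<dots> = (Idt V A \<otimes>\<^sub>a ((theta T \<otimes>\<^sub>a idTI) \<cdot> chi T \<I> \<I>)) \<cdot> s"
    by (simp add: colin[symmetric] interchange_Cmp)
  also have "\<dots> = s" by (simp add: chi_counit_left TArr_Idt)
  finally show ?thesis .
qed

text \<open>
  Let \<open>s : K B \<rightarrow> A \<otimes> T I\<close> be an isomorphism onto the cofree Hopf module and \<open>u : B \<rightarrow> A\<close> the arrow of
  the base that corresponds to it under the two adjunctions; then \<open>s\<close> is the canonical map after
  \<open>K u\<close>. As \<open>K\<close> is full, the canonical map is in turn \<open>s \<cdot> K v\<close> for some \<open>v : A \<rightarrow> B\<close>. The same
  adjunctions give \<open>u \<cdot> v = 1\<close>, so \<open>K u \<cdot> s\<inverse>\<close> inverts the canonical map.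
\<close>

lemma equivalence_can_iso:
  assumes K: "equivalence V Hopf (K_functor V T)" and A: "is_module V T A h"
  shows "is_iso V (can A h)"
proof -
  note [simp] = module_arr[OF A] can_arr[OF A]
  let ?K = "\<lambda>B. (FObj T B, mult T B, chi T B \<I>)"
  let ?h = "cofree_action A h" and ?r = "Idt V A \<otimes>\<^sub>a chi T \<I> \<I>"
  let ?G = "(A \<otimes> TI, ?h, ?r)"
  let ?c = "Idt V A \<otimes>\<^sub>a theta T"
  have K_Obj: "FObj (K_functor V T) B = ?K B" for B by (simp add: K_functor_def)
  have KF: "cat_functor V Hopf (K_functor V T)" using K by (simp add: equivalence_def)
  have KH: "is_Hopf_module (FObj T B) (mult T B) (chi T B \<I>)" if "B \<in> Obj V" for B
    using cat_functor.FObj_Obj[OF KF that] by (simp add: K_Obj Hopf_Obj_iff)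
  note G = cofree_Hopf_module[OF A]
  have h_arr [simp]: "?h \<in> Arr V" "Dom V ?h = FObj T (A \<otimes> TI)" "Cod V ?h = A \<otimes> TI"
    by (simp_all add: cofree_action_def)
  have GObj: "?G \<in> Obj Hopf" using G by (simp add: Hopf_Obj_iff)
  obtain B S where [simp]: "B \<in> Obj V" and S: "S \<in> Hom Hopf (?K B) ?G" "is_iso Hopf S"
    by (rule equivalence_ess_surj[OF K GObj, unfolded K_Obj])
  obtain S' where S': "S' \<in> Hom Hopf ?G (?K B)" "S' \<cdot>\<^bsub>Hopf\<^esub> S = Idt Hopf (?K B)"
      "S \<cdot>\<^bsub>Hopf\<^esub> S' = Idt Hopf ?G"
    by (rule category.is_isoE[OF Hopf_category S(2,1)])
  obtain s where Ss: "S = (?K B, s, ?G)" and s: "s \<in> Hom V (FObj T B) (A \<otimes> TI)"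
      and smap: "is_Hopf_map (mult T B) (chi T B \<I>) s ?h ?r"
    using S(1) unfolding Hopf_Hom_iff by blast
  obtain s' where Ss': "S' = (?G, s', ?K B)" and s': "s' \<in> Hom V (A \<otimes> TI) (FObj T B)"
    using S'(1) unfolding Hopf_Hom_iff by blast
  have inv: "s' \<cdot> s = Idt V (FObj T B)" "s \<cdot> s' = Idt V (A \<otimes> TI)"
    using S'(2,3) by (simp_all add: Ss Ss' Hopf_Cmp Hopf_Idt)
  have [simp]: "s \<in> Arr V" "Dom V s = FObj T B" "Cod V s = A \<otimes> TI"
      "s' \<in> Arr V" "Dom V s' = A \<otimes> TI" "Cod V s' = FObj T B"
    using s s' by (simp_all add: Hom_iff)
  have can_Hom: "(?K A, can A h, ?G) \<in> Hom Hopf (?K A) ?G"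
    using KH[of A] G can_module_map[OF A] can_coassoc[OF A]
    by (simp add: Hopf_Hom_iff is_Hopf_map_def Hom_iff[of _ V] cofree_action_def)
  have "S' \<cdot>\<^bsub>Hopf\<^esub> (?K A, can A h, ?G) \<in> Hom Hopf (?K A) (?K B)"
    by (rule category.Cmp_Hom[OF Hopf_category can_Hom S'(1)])
  then obtain v where v: "v \<in> Hom V A B"
      "FArr (K_functor V T) v = S' \<cdot>\<^bsub>Hopf\<^esub> (?K A, can A h, ?G)"
    by (rule equivalence_full[OF K module_arr(1)[OF A] \<open>B \<in> Obj V\<close>, unfolded K_Obj])
  have [simp]: "v \<in> Arr V" "Dom V v = A" "Cod V v = B" using v(1) by (simp_all add: Hom_iff)
  have Tv: "FArr T v = s' \<cdot> can A h"
    using v(2) by (simp add: K_functor_def Ss' Hopf_Cmp)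
  define g where "g = ?c \<cdot> s"
  have [simp]: "g \<in> Arr V" "Dom V g = FObj T B" "Cod V g = A" by (simp_all add: g_def)
  define u where "u = g \<cdot> unit T B"
  have u: "u \<in> Hom V B A" by (simp add: u_def Hom_iff)
  then have [simp]: "u \<in> Arr V" "Dom V u = B" "Cod V u = A" by (simp_all add: Hom_iff)
  have sg: "s = (g \<otimes>\<^sub>a idTI) \<cdot> chi T B \<I>"
    using Hopf_map_to_cofree[of A B s] s smap by (simp add: g_def is_Hopf_map_def)
  have "g \<cdot> mult T B = ?c \<cdot> (?h \<cdot> FArr T s)"
    using smap by (simp add: g_def is_Hopf_map_def)
  also have "\<dots> = h \<cdot> FArr T g"
    using Cmp_rewrite[OF cofree_counit_module_map[OF A], of "FArr T s"] by (simp add: g_def)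
  finally have g_map: "g \<cdot> mult T B = h \<cdot> FArr T g" .
  \<comment> \<open>Both \<open>g\<close> and \<open>h \<cdot> T u\<close> are module maps on the free module \<open>T B\<close> with restriction \<open>u\<close>; they agree.\<close>
  have "h \<cdot> FArr T u = g \<cdot> (mult T B \<cdot> FArr T (unit T B))"
    using Cmp_rewrite[OF g_map, of "FArr T (unit T B)"] by (simp add: u_def)
  then have hTu: "h \<cdot> FArr T u = g" by (simp add: mult_unit_right)
  have tTu: "can A h \<cdot> FArr T u = s"
    using can_precompose[OF A u] sg by (simp add: hTu)
  have "s \<cdot> FArr T v = can A h"
    using Cmp_rewrite[OF inv(2), of "can A h"] by (simp add: Tv)
  then have "can A h \<cdot> FArr T (u \<cdot> v) = can A h"
    using Cmp_rewrite[OF tTu, of "FArr T v"] by simp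
  then have "?c \<cdot> (can A h \<cdot> FArr T (u \<cdot> v)) = h" by (simp add: can_counit[OF A])
  then have "h \<cdot> FArr T (u \<cdot> v) = h"
    using Cmp_rewrite[OF can_counit[OF A], of "FArr T (u \<cdot> v)"] by simp
  then have "(h \<cdot> FArr T (u \<cdot> v)) \<cdot> unit T A = Idt V A" by (simp add: module_eqs[OF A])
  moreover have "FArr T (u \<cdot> v) \<cdot> unit T A = unit T A \<cdot> (u \<cdot> v)"
    using unit_natural[of "u \<cdot> v" A A] by (simp add: Hom_iff)
  ultimately have "(h \<cdot> unit T A) \<cdot> (u \<cdot> v) = Idt V A" by simp
  then have uv: "u \<cdot> v = Idt V A" by (simp add: module_eqs[OF A])
  show ?thesis
  proof (rule is_isoI)
    show "can A h \<in> Hom V (FObj T A) (A \<otimes> TI)" by (simp add: Hom_iff)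
    show "FArr T u \<cdot> s' \<in> Hom V (A \<otimes> TI) (FObj T A)" by (simp add: Hom_iff)
    have "(FArr T u \<cdot> s') \<cdot> can A h = FArr T (u \<cdot> v)" by (simp add: Tv)
    then show "(FArr T u \<cdot> s') \<cdot> can A h = Idt V (FObj T A)" by (simp add: uv)
    show "can A h \<cdot> (FArr T u \<cdot> s') = Idt V (A \<otimes> TI)"
      using Cmp_rewrite[OF tTu, of s'] by (simp add: inv)
  qed
qed

section \<open>Coalgebras over the comonad of free modules\<close>

text \<open>
  The arrows of \<open>Coalg\<close> are triples whose middle component is an arrow of \<open>EM\<close>, which is itself a
  tagged arrow of \<open>V\<close>. The predicates below state all axioms for the untagged arrows, so that they can be
  compared with those of Hopf modules; the constructor \<open>coalgebra\<close> restores the tags.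
\<close>

definition is_coalgebra :: "'o \<Rightarrow> 'a \<Rightarrow> 'a \<Rightarrow> bool" where
  "is_coalgebra A h r \<longleftrightarrow> is_module V T A h \<and> r \<in> Hom V A (FObj T A) \<and>
    r \<cdot> h = mult T A \<cdot> FArr T r \<and> FArr T (unit T A) \<cdot> r = FArr T r \<cdot> r \<and> h \<cdot> r = Idt V A"

definition is_coalgebra_map :: "'a \<Rightarrow> 'a \<Rightarrow> 'a \<Rightarrow> 'a \<Rightarrow> 'a \<Rightarrow> bool" where
  "is_coalgebra_map h r f k s \<longleftrightarrow> f \<cdot> h = k \<cdot> FArr T f \<and> s \<cdot> f = FArr T f \<cdot> r"

abbreviation EM where "EM \<equiv> EM_category V T"
abbreviation Coalg where "Coalg \<equiv> coalgebra_category EM (free_comonad V T)"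

definition coalgebra :: "'o \<Rightarrow> 'a \<Rightarrow> 'a \<Rightarrow> ('o \<times> 'a) \<times> ('o \<times> 'a) \<times> 'a \<times> ('o \<times> 'a)" where
  "coalgebra A h r = ((A, h), (A, h), r, free_module T A)"

lemma EM_Obj_iff: "(A, h) \<in> Obj EM \<longleftrightarrow> is_module V T A h"
  by (simp add: EM_category_def structured_category_def)

lemma EM_Hom_iff:
  "F \<in> Hom EM (A, h) (B, k) \<longleftrightarrow> (\<exists>f. F = ((A, h), f, (B, k)) \<and>
    is_module V T A h \<and> is_module V T B k \<and> f \<in> Hom V A B \<and> f \<cdot> h = k \<cdot> FArr T f)"
  by (auto simp: EM_category_def structured_category_Hom module_map_def)

lemma EM_Cmp: "(Y', g, Z) \<cdot>\<^bsub>EM\<^esub> (X, f, Y) = (X, g \<cdot> f, Z)"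
  by (simp add: EM_category_def structured_category_def)

lemma EM_Idt: "Idt EM (A, h) = ((A, h), Idt V A, (A, h))"
  by (simp add: EM_category_def structured_category_def)

lemma EM_category_category: "category EM"
  unfolding EM_category_def
proof (rule structured_category_category)
  fix X assume "X \<in> {(A, h). is_module V T A h}"
  then obtain A h where X: "X = (A, h)" and M: "is_module V T A h" by auto
  note [simp] = module_arr[OF M]
  show "fst X \<in> Obj V" "module_map V T (snd X) (Idt V (fst X)) (snd X)"
    by (simp_all add: X module_map_def)
next
  fix X Y Z f g
  assume XYZ: "X \<in> {(A, h). is_module V T A h}" "Y \<in> {(A, h). is_module V T A h}"
      "Z \<in> {(A, h). is_module V T A h}"
    and f: "f \<in> Hom V (fst X) (fst Y)" and g: "g \<in> Hom V (fst Y) (fst Z)"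
    and Pf: "module_map V T (snd X) f (snd Y)" and Pg: "module_map V T (snd Y) g (snd Z)"
  obtain A h B k C l where X: "X = (A, h)" and Y: "Y = (B, k)" and Z: "Z = (C, l)"
    by (cases X, cases Y, cases Z) auto
  from XYZ have M: "is_module V T A h" "is_module V T B k" "is_module V T C l"
    by (simp_all add: X Y Z)
  note [simp] = module_arr[OF M(1)] module_arr[OF M(2)] module_arr[OF M(3)]
  have [simp]: "f \<in> Arr V" "Dom V f = A" "Cod V f = B" "g \<in> Arr V" "Dom V g = B" "Cod V g = C"
    using f g by (simp_all add: Hom_iff X Y Z)
  have eqs: "f \<cdot> h = k \<cdot> FArr T f" "g \<cdot> k = l \<cdot> FArr T g"
    using Pf Pg by (simp_all add: X Y Z module_map_def)
  have "(g \<cdot> f) \<cdot> h = l \<cdot> FArr T (g \<cdot> f)"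
    using Cmp_rewrite[OF eqs(2), of "FArr T f"] by (simp add: eqs(1))
  then show "module_map V T (snd X) (g \<cdot> f) (snd Z)"
    by (simp add: X Z module_map_def)
qed

lemma free_comonad_simps:
  "FObj (free_comonad V T) X = free_module T (fst X)"
  "FArr (free_comonad V T) (X, f, Y) = (free_module T (Dom V f), FArr T f, free_module T (Cod V f))"
  "counit (free_comonad V T) X = (free_module T (fst X), snd X, X)"
  "A \<in> Obj V \<Longrightarrow> comult (free_comonad V T) (A, h)
    = (free_module T A, FArr T (unit T A), free_module T (FObj T A))"
  by (simp_all add: free_comonad_def adjunction_comonad_def comp_functor_def free_functor_def
      forgetful_functor_def EM_counit_def)

lemma Coalg_Obj_iff: "X \<in> Obj Coalg \<longleftrightarrow> (\<exists>A h r. X = coalgebra A h r \<and> is_coalgebra A h r)"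
proof -
  obtain A h R where X: "X = ((A, h), R)" by (cases X) auto
  have "X \<in> Obj Coalg \<longleftrightarrow> (A, h) \<in> Obj EM \<and> R \<in> Hom EM (A, h) (free_module T A) \<and>
      comult (free_comonad V T) (A, h) \<cdot>\<^bsub>EM\<^esub> R = FArr (free_comonad V T) R \<cdot>\<^bsub>EM\<^esub> R \<and>
      counit (free_comonad V T) (A, h) \<cdot>\<^bsub>EM\<^esub> R = Idt EM (A, h)"
    by (simp add: X coalgebra_category_def structured_category_def free_comonad_simps(1))
  also have "\<dots> \<longleftrightarrow> (\<exists>r. R = ((A, h), r, free_module T A) \<and> is_coalgebra A h r)"
    using module_arr[of A h] free_is_module[of A]
    by (auto simp: EM_Obj_iff EM_Hom_iff free_module_def free_comonad_simps EM_Cmp EM_Idt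
        is_coalgebra_def Hom_iff[of _ V])
  also have "\<dots> \<longleftrightarrow> (\<exists>A h r. X = coalgebra A h r \<and> is_coalgebra A h r)"
    by (auto simp: X coalgebra_def)
  finally show ?thesis .
qed

lemma Coalg_Obj: "coalgebra A h r \<in> Obj Coalg \<longleftrightarrow> is_coalgebra A h r"
  by (auto simp: Coalg_Obj_iff) (simp_all add: coalgebra_def)

lemma Coalg_structured:
  "Coalg = structured_category EM (Obj Coalg) fst
    (\<lambda>X f Y. snd Y \<cdot>\<^bsub>EM\<^esub> f = FArr (free_comonad V T) f \<cdot>\<^bsub>EM\<^esub> snd X)"
  by (simp add: coalgebra_category_def structured_category_def)

lemma Coalg_Hom_iff:
  "F \<in> Hom Coalg (coalgebra A h r) (coalgebra B k s) \<longleftrightarrow>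
    (\<exists>f. F = (coalgebra A h r, ((A, h), f, (B, k)), coalgebra B k s) \<and>
      is_coalgebra A h r \<and> is_coalgebra B k s \<and> f \<in> Hom V A B \<and> is_coalgebra_map h r f k s)"
proof -
  have "F \<in> Hom Coalg (coalgebra A h r) (coalgebra B k s) \<longleftrightarrow>
    (\<exists>E. F = (coalgebra A h r, E, coalgebra B k s) \<and>
      is_coalgebra A h r \<and> is_coalgebra B k s \<and> E \<in> Hom EM (A, h) (B, k) \<and>
      ((B, k), s, free_module T B) \<cdot>\<^bsub>EM\<^esub> E
        = FArr (free_comonad V T) E \<cdot>\<^bsub>EM\<^esub> ((A, h), r, free_module T A))"
    by (subst Coalg_structured) (simp only: structured_category_Hom Coalg_Obj, simp add: coalgebra_def)
  then show ?thesis
    by (auto simp: EM_Hom_iff EM_Cmp free_comonad_simps is_coalgebra_map_def is_coalgebra_def Hom_iff[of _ V])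
qed

lemma Coalg_Cmp: "(Y', g, Z) \<cdot>\<^bsub>Coalg\<^esub> (X, f, Y) = (X, g \<cdot>\<^bsub>EM\<^esub> f, Z)"
  by (simp add: coalgebra_category_def structured_category_def)

lemma Coalg_Idt:
  "Idt Coalg (coalgebra A h r) = (coalgebra A h r, ((A, h), Idt V A, (A, h)), coalgebra A h r)"
  by (simp add: coalgebra_category_def structured_category_def coalgebra_def EM_Idt)

lemma Coalg_category: "category Coalg"
proof (subst Coalg_structured, rule category.structured_category_category[OF EM_category_category])
  fix X assume "X \<in> Obj Coalg"
  then obtain A h r where X: "X = coalgebra A h r" and c: "is_coalgebra A h r"
    by (auto simp: Coalg_Obj_iff)
  then have M: "is_module V T A h" and r: "r \<in> Arr V" "Dom V r = A" "Cod V r = FObj T A"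
    by (simp_all add: is_coalgebra_def Hom_iff[of _ V])
  show "fst X \<in> Obj EM" using M by (simp add: X coalgebra_def EM_Obj_iff)
  show "snd X \<cdot>\<^bsub>EM\<^esub> Idt EM (fst X) = FArr (free_comonad V T) (Idt EM (fst X)) \<cdot>\<^bsub>EM\<^esub> snd X"
    using module_arr[OF M] r by (simp add: X coalgebra_def EM_Idt EM_Cmp free_comonad_simps)
next
  fix X Y Z f g
  assume XYZ: "X \<in> Obj Coalg" "Y \<in> Obj Coalg" "Z \<in> Obj Coalg"
    and f: "f \<in> Hom EM (fst X) (fst Y)" and g: "g \<in> Hom EM (fst Y) (fst Z)"
    and Pf: "snd Y \<cdot>\<^bsub>EM\<^esub> f = FArr (free_comonad V T) f \<cdot>\<^bsub>EM\<^esub> snd X"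
    and Pg: "snd Z \<cdot>\<^bsub>EM\<^esub> g = FArr (free_comonad V T) g \<cdot>\<^bsub>EM\<^esub> snd Y"
  obtain A h r B k s C l t where X: "X = coalgebra A h r" and Y: "Y = coalgebra B k s"
      and Z: "Z = coalgebra C l t"
      and c: "is_coalgebra A h r" "is_coalgebra B k s" "is_coalgebra C l t"
    using XYZ by (auto simp: Coalg_Obj_iff)
  from c have [simp]: "r \<in> Arr V" "Dom V r = A" "Cod V r = FObj T A"
      "s \<in> Arr V" "Dom V s = B" "Cod V s = FObj T B" "t \<in> Arr V" "Dom V t = C" "Cod V t = FObj T C"
    by (simp_all add: is_coalgebra_def Hom_iff[of _ V])
  obtain f' g' where f': "f = ((A, h), f', (B, k))" and g': "g = ((B, k), g', (C, l))"
      and [simp]: "f' \<in> Arr V" "Dom V f' = A" "Cod V f' = B" "g' \<in> Arr V" "Dom V g' = B" "Cod V g' = C"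
    using f g by (auto simp: X Y Z coalgebra_def EM_Hom_iff Hom_iff[of _ V])
  have eqs: "s \<cdot> f' = FArr T f' \<cdot> r" "t \<cdot> g' = FArr T g' \<cdot> s"
    using Pf Pg by (simp_all add: X Y Z f' g' coalgebra_def EM_Cmp free_comonad_simps)
  have "t \<cdot> (g' \<cdot> f') = FArr T (g' \<cdot> f') \<cdot> r"
    using Cmp_rewrite[OF eqs(2), of f'] by (simp add: eqs(1))
  then show "snd Z \<cdot>\<^bsub>EM\<^esub> (g \<cdot>\<^bsub>EM\<^esub> f) = FArr (free_comonad V T) (g \<cdot>\<^bsub>EM\<^esub> f) \<cdot>\<^bsub>EM\<^esub> snd X"
    by (simp add: X Z f' g' coalgebra_def EM_Cmp free_comonad_simps)
qed

section \<open>Coalgebras are Hopf modules when the canonical maps are invertible\<close>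

text \<open>
  Composition with the canonical map turns a coalgebra structure into a coaction. The counit axioms
  coincide, and the mixed Hopf module axiom is the module map axiom for \<open>r\<close> followed by the canonical map.
  Once \<open>r\<close> is a module map, naturality makes coassociativity of the coaction that of \<open>r\<close>, followed by
  the canonical map of the free module and then by \<open>can A h \<otimes> T I\<close>. Invertible arrows cancel.
\<close>

lemma is_Hopf_module_can_iff:
  assumes iso: "\<And>A h. is_module V T A h \<Longrightarrow> is_iso V (can A h)"
    and A: "is_module V T A h" and r: "r \<in> Hom V A (FObj T A)"
  shows "is_Hopf_module A h (can A h \<cdot> r) \<longleftrightarrow> is_coalgebra A h r"
proof -
  note [simp] = module_arr[OF A] can_arr[OF A]
  note F = free_is_module[OF \<open>A \<in> Obj V\<close>]
  note [simp] = can_arr[OF F]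
  have [simp]: "r \<in> Arr V" "Dom V r = A" "Cod V r = FObj T A"
    using r by (simp_all add: Hom_iff)
  let ?t = "can A h" and ?\<beta> = "can (FObj T A) (mult T A)"
  have counit: "(Idt V A \<otimes>\<^sub>a theta T) \<cdot> (?t \<cdot> r) = h \<cdot> r"
    using Cmp_rewrite[OF can_counit[OF A], of r] by simp
  have "(h \<otimes>\<^sub>a mult T \<I>) \<cdot> (chi T A TI \<cdot> FArr T (?t \<cdot> r)) = ?t \<cdot> (mult T A \<cdot> FArr T r)"
    using Cmp_rewrite[OF can_module_map[OF A], of "FArr T r"] by simp
  then have action: "(?t \<cdot> r) \<cdot> h = (h \<otimes>\<^sub>a mult T \<I>) \<cdot> (chi T A TI \<cdot> FArr T (?t \<cdot> r)) \<longleftrightarrow>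
      r \<cdot> h = mult T A \<cdot> FArr T r"
    using iso_cancel_left[OF iso[OF A], of "r \<cdot> h" "mult T A \<cdot> FArr T r"] by auto
  have "((?t \<cdot> r) \<otimes>\<^sub>a idTI) \<cdot> (?t \<cdot> r) = (Idt V A \<otimes>\<^sub>a chi T \<I> \<I>) \<cdot> (?t \<cdot> r) \<longleftrightarrow>
      FArr T (unit T A) \<cdot> r = FArr T r \<cdot> r" if rh: "r \<cdot> h = mult T A \<cdot> FArr T r"
  proof -
    let ?k = "(?t \<otimes>\<^sub>a idTI) \<cdot> ?\<beta>"
    have "is_iso V (?t \<otimes>\<^sub>a idTI)"
    proof -
      obtain g where g: "g \<in> Hom V (A \<otimes> TI) (FObj T A)" "g \<cdot> ?t = Idt V (FObj T A)"
          "?t \<cdot> g = Idt V (A \<otimes> TI)"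
        by (rule is_isoE[OF iso[OF A], of "FObj T A" "A \<otimes> TI"]) (simp_all add: Hom_iff)
      then have [simp]: "g \<in> Arr V" "Dom V g = A \<otimes> TI" "Cod V g = FObj T A"
        by (simp_all add: Hom_iff)
      show ?thesis
        by (rule is_isoI[of _ "FObj T A \<otimes> TI" "(A \<otimes> TI) \<otimes> TI" "g \<otimes>\<^sub>a idTI"])
          (simp_all add: Hom_iff interchange g TArr_Idt)
    qed
    then have k: "is_iso V ?k" using iso[OF F] by (intro is_iso_Cmp) simp_all
    have r_nat: "?\<beta> \<cdot> FArr T r = (r \<otimes>\<^sub>a idTI) \<cdot> ?t"
      by (rule can_natural[OF A F r rh])
    have "((?t \<cdot> r) \<otimes>\<^sub>a idTI) \<cdot> (?t \<cdot> r) = (?t \<otimes>\<^sub>a idTI) \<cdot> ((r \<otimes>\<^sub>a idTI) \<cdot> (?t \<cdot> r))"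
      by (simp add: interchange_Cmp)
    also have "\<dots> = ?k \<cdot> (FArr T r \<cdot> r)"
      using Cmp_rewrite[OF r_nat, of r] by simp
    finally have 1: "((?t \<cdot> r) \<otimes>\<^sub>a idTI) \<cdot> (?t \<cdot> r) = ?k \<cdot> (FArr T r \<cdot> r)" .
    have "(Idt V A \<otimes>\<^sub>a chi T \<I> \<I>) \<cdot> (?t \<cdot> r) = (?t \<otimes>\<^sub>a idTI) \<cdot> (chi T A \<I> \<cdot> r)"
      using Cmp_rewrite[OF can_coassoc[OF A], of r] by simp
    also have "\<dots> = ?k \<cdot> (FArr T (unit T A) \<cdot> r)"
      using Cmp_rewrite[OF can_free_T_unit[of A], of r] by simp
    finally have 2: "(Idt V A \<otimes>\<^sub>a chi T \<I> \<I>) \<cdot> (?t \<cdot> r) = ?k \<cdot> (FArr T (unit T A) \<cdot> r)" .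
    show ?thesis
      unfolding 1 2
      using iso_cancel_left[OF k, of "FArr T (unit T A) \<cdot> r" "FArr T r \<cdot> r"] by (auto simp del: Cmp_assoc_arr)
  qed
  then show ?thesis
    using A counit action by (auto simp: is_Hopf_module_def is_coalgebra_def Hom_iff[of _ V])
qed

text \<open>If \<open>f\<close> is a module map, naturality of the canonical map rewrites the colinearity of \<open>f\<close> as the
  coalgebra map equation composed with the canonical map of the target, which cancels.\<close>

lemma is_Hopf_map_can_iff:
  assumes iso: "\<And>A h. is_module V T A h \<Longrightarrow> is_iso V (can A h)"
    and A: "is_module V T A h" and r: "r \<in> Hom V A (FObj T A)"
    and B: "is_module V T B k" and s: "s \<in> Hom V B (FObj T B)" and f: "f \<in> Hom V A B"
  shows "is_Hopf_map h (can A h \<cdot> r) f k (can B k \<cdot> s) \<longleftrightarrow> is_coalgebra_map h r f k s"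
proof (cases "f \<cdot> h = k \<cdot> FArr T f")
  case True
  note [simp] = module_arr[OF A] can_arr[OF A] module_arr[OF B] can_arr[OF B]
  have [simp]: "r \<in> Arr V" "Dom V r = A" "Cod V r = FObj T A" "s \<in> Arr V" "Dom V s = B"
      "Cod V s = FObj T B" "f \<in> Arr V" "Dom V f = A" "Cod V f = B"
    using r s f by (simp_all add: Hom_iff)
  have "(f \<otimes>\<^sub>a idTI) \<cdot> (can A h \<cdot> r) = can B k \<cdot> (FArr T f \<cdot> r)"
    using Cmp_rewrite[OF can_natural[OF A B f True], of r] by simp
  then show ?thesis
    using True iso_cancel_left[OF iso[OF B], of "s \<cdot> f" "FArr T f \<cdot> r"]
    by (auto simp: is_Hopf_map_def is_coalgebra_map_def)
qed (simp add: is_Hopf_map_def is_coalgebra_map_def)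

definition can_inverse :: "'o \<Rightarrow> 'a \<Rightarrow> 'a" where
  "can_inverse A h = (SOME g. g \<in> Hom V (A \<otimes> TI) (FObj T A) \<and>
    g \<cdot> can A h = Idt V (FObj T A) \<and> can A h \<cdot> g = Idt V (A \<otimes> TI))"

lemma can_inverse:
  assumes "is_iso V (can A h)" "is_module V T A h"
  shows "can_inverse A h \<in> Hom V (A \<otimes> TI) (FObj T A)"
    "can_inverse A h \<cdot> can A h = Idt V (FObj T A)" "can A h \<cdot> can_inverse A h = Idt V (A \<otimes> TI)"
proof -
  have "\<exists>g. g \<in> Hom V (A \<otimes> TI) (FObj T A) \<and>
    g \<cdot> can A h = Idt V (FObj T A) \<and> can A h \<cdot> g = Idt V (A \<otimes> TI)"
    using is_isoE[OF assms(1), of "FObj T A" "A \<otimes> TI"] can_arr[OF assms(2)]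
    by (metis Hom_iff)
  from someI_ex[OF this] show "can_inverse A h \<in> Hom V (A \<otimes> TI) (FObj T A)"
    "can_inverse A h \<cdot> can A h = Idt V (FObj T A)" "can A h \<cdot> can_inverse A h = Idt V (A \<otimes> TI)"
    by (auto simp: can_inverse_def)
qed

definition coalgebra_to_Hopf ::
    "(('o \<times> 'a) \<times> ('o \<times> 'a) \<times> 'a \<times> ('o \<times> 'a),
      (('o \<times> 'a) \<times> ('o \<times> 'a) \<times> 'a \<times> ('o \<times> 'a)) \<times> (('o \<times> 'a) \<times> 'a \<times> ('o \<times> 'a))
        \<times> (('o \<times> 'a) \<times> ('o \<times> 'a) \<times> 'a \<times> ('o \<times> 'a)),
      'o \<times> 'a \<times> 'a, ('o \<times> 'a \<times> 'a) \<times> 'a \<times> ('o \<times> 'a \<times> 'a)) cat_functor" where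
  "coalgebra_to_Hopf =
    (let P = (\<lambda>((A, h), (X, r, Y)). (A, h, can A h \<cdot> r))
     in \<lparr>FObj = P, FArr = (\<lambda>(X, (M, f, N), Y). (P X, f, P Y))\<rparr>)"

definition Hopf_to_coalgebra where
  "Hopf_to_coalgebra =
    (let Q = (\<lambda>(A, h, r). coalgebra A h (can_inverse A h \<cdot> r))
     in \<lparr>FObj = Q, FArr = (\<lambda>(X, f, Y). (Q X, (fst (Q X), f, fst (Q Y)), Q Y))\<rparr>)"

lemma coalgebra_to_Hopf_simps:
  "FObj coalgebra_to_Hopf (coalgebra A h r) = (A, h, can A h \<cdot> r)"
  "FArr coalgebra_to_Hopf (coalgebra A h r, (M, f, N), coalgebra B k s)
    = ((A, h, can A h \<cdot> r), f, (B, k, can B k \<cdot> s))"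
  by (simp_all add: coalgebra_to_Hopf_def coalgebra_def Let_def)

lemma Hopf_to_coalgebra_simps:
  "FObj Hopf_to_coalgebra (A, h, r) = coalgebra A h (can_inverse A h \<cdot> r)"
  "FArr Hopf_to_coalgebra ((A, h, r), f, (B, k, s))
    = (coalgebra A h (can_inverse A h \<cdot> r), ((A, h), f, (B, k)), coalgebra B k (can_inverse B k \<cdot> s))"
  by (simp_all add: Hopf_to_coalgebra_def coalgebra_def Let_def)

lemma Coalg_Hom_E:
  assumes "F \<in> Hom Coalg X Y"
  obtains A h r B k s f where "X = coalgebra A h r" "Y = coalgebra B k s"
    "F = (coalgebra A h r, ((A, h), f, (B, k)), coalgebra B k s)"
    "is_coalgebra A h r" "is_coalgebra B k s" "f \<in> Hom V A B" "is_coalgebra_map h r f k s"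
proof -
  have "X \<in> Obj Coalg" "Y \<in> Obj Coalg"
    using assms category.Dom_Obj[OF Coalg_category, of F]
      category.Cod_Obj[OF Coalg_category, of F]
    by (auto simp: Hom_iff)
  then obtain A h r B k s where "X = coalgebra A h r" "Y = coalgebra B k s"
    by (auto simp: Coalg_Obj_iff)
  with assms that show thesis by (auto simp: Coalg_Hom_iff)
qed

lemma coalgebra_to_Hopf_functor:
  assumes iso: "\<And>A h. is_module V T A h \<Longrightarrow> is_iso V (can A h)"
  shows "cat_functor Coalg Hopf coalgebra_to_Hopf"
proof (intro cat_functor.intro cat_functor_axioms.intro Coalg_category Hopf_category)
  have coalg: "is_Hopf_module A h (can A h \<cdot> r)" "is_module V T A h" "r \<in> Hom V A (FObj T A)"
    if "is_coalgebra A h r" for A h r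
    using is_Hopf_module_can_iff[OF iso, of A h r] that by (simp_all add: is_coalgebra_def)
  {
    fix X assume "X \<in> Obj Coalg"
    then obtain A h r where X: "X = coalgebra A h r" "is_coalgebra A h r"
      by (auto simp: Coalg_Obj_iff)
    then show "FObj coalgebra_to_Hopf X \<in> Obj Hopf"
      "FArr coalgebra_to_Hopf (Idt Coalg X) = Idt Hopf (FObj coalgebra_to_Hopf X)"
      by (simp_all add: coalgebra_to_Hopf_simps Hopf_Obj_iff coalg Coalg_Idt Hopf_Idt)
  next
    fix F X Y assume "F \<in> Hom Coalg X Y"
    then show "FArr coalgebra_to_Hopf F
        \<in> Hom Hopf (FObj coalgebra_to_Hopf X) (FObj coalgebra_to_Hopf Y)"
      by (elim Coalg_Hom_E)
        (simp add: coalgebra_to_Hopf_simps Hopf_Hom_iff coalg is_Hopf_map_can_iff[OF iso])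
  next
    fix F G X Y Z assume F: "F \<in> Hom Coalg X Y" and G: "G \<in> Hom Coalg Y Z"
    then show "FArr coalgebra_to_Hopf (G \<cdot>\<^bsub>Coalg\<^esub> F)
        = FArr coalgebra_to_Hopf G \<cdot>\<^bsub>Hopf\<^esub> FArr coalgebra_to_Hopf F"
      by (elim Coalg_Hom_E)
        (simp add: Coalg_Cmp EM_Cmp coalgebra_to_Hopf_simps Hopf_Cmp)
  }
qed

lemma Hopf_Hom_E:
  assumes "F \<in> Hom Hopf X Y"
  obtains A h r B k s f where "X = (A, h, r)" "Y = (B, k, s)" "F = ((A, h, r), f, (B, k, s))"
    "is_Hopf_module A h r" "is_Hopf_module B k s" "f \<in> Hom V A B" "is_Hopf_map h r f k s"
  using assms that by (cases X; cases Y) (auto simp: Hopf_Hom_iff)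

lemma can_inverse_Cmp:
  assumes iso: "is_iso V (can A h)" and A: "is_module V T A h"
  shows "r \<in> Hom V A (A \<otimes> TI) \<Longrightarrow> can_inverse A h \<cdot> r \<in> Hom V A (FObj T A)"
    "r \<in> Hom V A (A \<otimes> TI) \<Longrightarrow> can A h \<cdot> (can_inverse A h \<cdot> r) = r"
    "s \<in> Hom V A (FObj T A) \<Longrightarrow> can_inverse A h \<cdot> (can A h \<cdot> s) = s"
  using Cmp_rewrite[OF can_inverse(2)[OF assms], of s] Cmp_rewrite[OF can_inverse(3)[OF assms], of r]
    can_inverse(1)[OF assms] can_arr[OF A] by (auto simp: Hom_iff)

lemma Hopf_module_coalgebra:
  assumes iso: "\<And>A h. is_module V T A h \<Longrightarrow> is_iso V (can A h)" and H: "is_Hopf_module A h r"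
  shows "is_coalgebra A h (can_inverse A h \<cdot> r)"
proof -
  have A: "is_module V T A h" "r \<in> Hom V A (A \<otimes> TI)" using H by (simp_all add: is_Hopf_module_def)
  show ?thesis
    using is_Hopf_module_can_iff[OF iso A(1) can_inverse_Cmp(1)[OF iso[OF A(1)] A]] H
    by (simp add: can_inverse_Cmp(2)[OF iso[OF A(1)] A])
qed

lemma Hopf_to_coalgebra_functor:
  assumes iso: "\<And>A h. is_module V T A h \<Longrightarrow> is_iso V (can A h)"
  shows "cat_functor Hopf Coalg Hopf_to_coalgebra"
proof (intro cat_functor.intro cat_functor_axioms.intro Coalg_category Hopf_category)
  {
    fix X assume "X \<in> Obj Hopf"
    then obtain A h r where "X = (A, h, r)" "is_Hopf_module A h r"
      by (cases X) (auto simp: Hopf_Obj_iff)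
    then show "FObj Hopf_to_coalgebra X \<in> Obj Coalg"
      "FArr Hopf_to_coalgebra (Idt Hopf X) = Idt Coalg (FObj Hopf_to_coalgebra X)"
      using Hopf_module_coalgebra[OF iso, of A h r]
      by (simp_all add: Hopf_to_coalgebra_simps Coalg_Obj Coalg_Idt Hopf_Idt)
  next
    fix F X Y assume "F \<in> Hom Hopf X Y"
    then show "FArr Hopf_to_coalgebra F
        \<in> Hom Coalg (FObj Hopf_to_coalgebra X) (FObj Hopf_to_coalgebra Y)"
    proof (cases rule: Hopf_Hom_E)
      case (1 A h r B k s f)
      then have M: "is_module V T A h" "r \<in> Hom V A (A \<otimes> TI)" "is_module V T B k" "s \<in> Hom V B (B \<otimes> TI)"
        by (simp_all add: is_Hopf_module_def)
      note A = can_inverse_Cmp(1,2)[OF iso[OF M(1)] M(1,2)]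
        and B = can_inverse_Cmp(1,2)[OF iso[OF M(3)] M(3,4)]
      show ?thesis
        using is_Hopf_map_can_iff[OF iso M(1) A(1) M(3) B(1) 1(6)] 1
        by (simp add: Hopf_to_coalgebra_simps Coalg_Hom_iff Hopf_module_coalgebra[OF iso] A(2) B(2))
    qed
  next
    fix F G X Y Z assume "F \<in> Hom Hopf X Y" "G \<in> Hom Hopf Y Z"
    then show "FArr Hopf_to_coalgebra (G \<cdot>\<^bsub>Hopf\<^esub> F)
        = FArr Hopf_to_coalgebra G \<cdot>\<^bsub>Coalg\<^esub> FArr Hopf_to_coalgebra F"
      by (elim Hopf_Hom_E)
        (simp add: Coalg_Cmp EM_Cmp Hopf_to_coalgebra_simps Hopf_Cmp)
  }
qed

abbreviation Comparison where "Comparison \<equiv> comparison_functor V (free_functor V T) (unit T)"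

lemma Comparison_simps:
  assumes "A \<in> Obj V"
  shows "FObj Comparison A = coalgebra (FObj T A) (mult T A) (FArr T (unit T A))"
  using assms by (simp add: comparison_functor_def free_functor_def free_module_def coalgebra_def)

lemma Comparison_FArr:
  assumes "f \<in> Arr V"
  shows "FArr Comparison f = (FObj Comparison (Dom V f),
    (free_module T (Dom V f), FArr T f, free_module T (Cod V f)), FObj Comparison (Cod V f))"
  by (simp add: comparison_functor_def free_functor_def Let_def)

lemma K_eq:
  "A \<in> Obj V \<Longrightarrow> FObj (K_functor V T) A = FObj coalgebra_to_Hopf (FObj Comparison A)"
  "f \<in> Arr V \<Longrightarrow> FArr (K_functor V T) f = FArr coalgebra_to_Hopf (FArr Comparison f)"
  by (simp_all add: Comparison_FArr Comparison_simps coalgebra_to_Hopf_simps can_free_T_unit K_functor_def)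

lemma equivalence_K_iff:
  assumes iso: "\<And>A h. is_module V T A h \<Longrightarrow> is_iso V (can A h)"
  shows "equivalence V Hopf (K_functor V T) \<longleftrightarrow> effective_descent_type V T"
proof -
  note P = coalgebra_to_Hopf_functor[OF iso] and Q = Hopf_to_coalgebra_functor[OF iso]
  have QP_Obj: "FObj Hopf_to_coalgebra (FObj coalgebra_to_Hopf X) = X" if "X \<in> Obj Coalg" for X
    using that by (auto simp: Coalg_Obj_iff is_coalgebra_def coalgebra_to_Hopf_simps
        Hopf_to_coalgebra_simps can_inverse_Cmp(3)[OF iso])
  have QP_Arr: "FArr Hopf_to_coalgebra (FArr coalgebra_to_Hopf F) = F" if "F \<in> Arr Coalg" for F
    using category.Arr_Hom[OF Coalg_category that]
    by (elim Coalg_Hom_E) (simp add: is_coalgebra_def coalgebra_to_Hopf_simps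
        Hopf_to_coalgebra_simps can_inverse_Cmp(3)[OF iso])
  have PQ_Obj: "FObj coalgebra_to_Hopf (FObj Hopf_to_coalgebra X) = X" if "X \<in> Obj Hopf" for X
    using that by (cases X) (simp add: Hopf_Obj_iff is_Hopf_module_def coalgebra_to_Hopf_simps
        Hopf_to_coalgebra_simps can_inverse_Cmp(2)[OF iso])
  have PQ_Arr: "FArr coalgebra_to_Hopf (FArr Hopf_to_coalgebra F) = F" if "F \<in> Arr Hopf" for F
    using category.Arr_Hom[OF Hopf_category that]
    by (elim Hopf_Hom_E) (simp add: is_Hopf_module_def coalgebra_to_Hopf_simps
        Hopf_to_coalgebra_simps can_inverse_Cmp(2)[OF iso])
  have Obj: "FObj Comparison A \<in> Obj Coalg" if A: "A \<in> Obj V" for A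
  proof -
    note [simp] = A and M = free_is_module[OF A]
    have eA: "unit T A \<in> Hom V A (FObj T A)" by (simp add: Hom_iff)
    have "FArr T (unit T A) \<cdot> mult T A = mult T (FObj T A) \<cdot> FArr T (FArr T (unit T A))"
      by (simp add: mult_natural[OF eA])
    moreover have "unit T (FObj T A) \<cdot> unit T A = FArr T (unit T A) \<cdot> unit T A"
      by (rule unit_natural[OF eA])
    then have "FArr T (unit T (FObj T A) \<cdot> unit T A) = FArr T (FArr T (unit T A) \<cdot> unit T A)"
      by simp
    ultimately show ?thesis
      using M by (simp add: Comparison_simps Coalg_Obj is_coalgebra_def Hom_iff mult_unit_right)
  qed
  have Arr: "FArr Comparison f \<in> Arr Coalg" if f: "f \<in> Arr V" for f
  proof -
    define A B where AB: "A = Dom V f" "B = Cod V f"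
    note [simp] = f AB[symmetric]
    have [simp]: "A \<in> Obj V" "B \<in> Obj V" by (simp_all add: AB del: AB[symmetric])
    have f': "f \<in> Hom V A B" by (simp add: Hom_iff)
    have "is_coalgebra_map (mult T A) (FArr T (unit T A)) (FArr T f) (mult T B) (FArr T (unit T B))"
      using mult_natural[OF f'] unit_natural[OF f'] T_Cmp[of f "unit T B"] T_Cmp[of "unit T A" "FArr T f"]
      by (simp add: is_coalgebra_map_def del: T_Cmp)
    then have "FArr Comparison f \<in> Hom Coalg (FObj Comparison A) (FObj Comparison B)"
      using Obj[of A] Obj[of B]
      by (simp add: Comparison_FArr Comparison_simps Coalg_Hom_iff Coalg_Obj free_module_def Hom_iff[of _ V])
    then show ?thesis by (simp add: Hom_iff)
  qed
  show ?thesis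
  proof
    assume "equivalence V Hopf (K_functor V T)"
    then show "effective_descent_type V T"
      unfolding effective_descent_type_def
      by (rule equivalence_transport[OF _ Q P PQ_Obj PQ_Arr QP_Obj QP_Arr])
        (simp_all add: K_eq QP_Obj QP_Arr Obj Arr)
  next
    assume "effective_descent_type V T"
    then show "equivalence V Hopf (K_functor V T)"
      unfolding effective_descent_type_def
      by (rule equivalence_transport[OF _ P Q QP_Obj QP_Arr PQ_Obj PQ_Arr])
        (simp_all add: K_eq)
  qed
qed

end

theorem theorem3p7:
  fixes V :: "('o, 'a) monoidal_category" and T :: "('o, 'a) opmonoidal_monad"
  assumes "opmonoidal_monad V T"
  shows "equivalence V (Hopf_module_category V T) (K_functor V T)
    \<longleftrightarrow> Galois V T \<and> effective_descent_type V T"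
proof -
  interpret opmonoidal_monad V T by fact
  show ?thesis
  proof (intro iffI conjI)
    assume K: "equivalence V (Hopf_module_category V T) (K_functor V T)"
    then show "Galois V T"
      unfolding Galois_def can_free[symmetric]
      by (blast intro: equivalence_can_iso free_is_module)
    show "effective_descent_type V T"
      using K equivalence_K_iff equivalence_can_iso[OF K] by blast
  next
    assume "Galois V T \<and> effective_descent_type V T"
    then show "equivalence V (Hopf_module_category V T) (K_functor V T)"
      using equivalence_K_iff Galois_can_iso by blast
  qed
qed

end
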